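(* Let $(\Omega,S)$ be a scheme and $k$ a positive integer. The following are equivalent: (1) $(\Omega,S)$ is pseudocyclic with $m_P/n_P=k$ for all $P\in\mathcal P^\#$; (2) $(\Omega,S)$ is an equivalenced scheme of valency $k$ with $c(r)=k-1$ for all $r\in S^\#$. Moreover, if $(\Omega,S)$ is pseudocyclic and $n_P$ takes the same value for all $P\in\mathcal P^\#$, then $(\Omega,S)$ is commutative.
   Context: A coherent configuration is a pair $(\Omega,S)$ where $\Omega$ is a finite set and $S$ is a partition of $\Omega\times\Omega$ such that: the diagonal $1_\Omega=\{(\alpha,\alpha):\alpha\in\Omega\}$ is a union of elements of $S$; $S$ is closed under $r\mapsto r^*=\{(\beta,\alpha):(\alpha,\beta)\in r\}$; and for all $r,s,t\in S$ the number $c_{rs}^t=|\{\beta\in\Omega:(\alpha,\beta)\in r,\ (\beta,\gamma)\in s\}|$ does not depend on the choice of $(\alpha,\gamma)\in t$. A scheme is a coherent configuration with $1_\Omega\in S$; $S^\#=S\setminus\{1_\Omega\}$; for $s\in S$ and $\alpha\in\Omega$, $\alpha s=\{\beta:(\alpha,\beta)\in s\}$, and in a scheme $n_s=|\alpha s|$ does not depend on $\alpha$ (valency of $s$). A scheme is equivalenced of valency $k$ if $n_s=k$ for all $s\in S^\#$. For $s\in S$, $c(s)=\sum_{t\in S}c_{tt^*}^s$. The adjacency algebra $\mathbb{C}S$ is the span of the adjacency matrices $A(s)$, $s\in S$; let $\mathcal P$ be its set of central primitive idempotents; for $P\in\mathcal P$, $n_P$ is the dimension of an irreducible $\mathbb{C}S$-submodule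 of $\mathbb{C}^\Omega$ corresponding to $P$ and $m_P=\operatorname{rk}(P)/n_P$; $P_0=\frac1{|\Omega|}J$ and $\mathcal P^\#=\mathcal P\setminus\{P_0\}$. A scheme is pseudocyclic if $m_P/n_P$ is the same for all $P\in\mathcal P^\#$, and commutative if $\mathbb{C}S$ is commutative. *)

theory Defs
  imports "HOL-Analysis.Analysis"
begin

text \<open>The point set \<Omega> is the (finite) universe of a type 'n; relations are
  subsets of 'n \<times> 'n; S is a set of relations.\<close>

definition coherent_config :: "('n::finite \<times> 'n) set set \<Rightarrow> bool" where
  "coherent_config S \<longleftrightarrow>
     (\<forall>s\<in>S. s \<noteq> {}) \<and>
     (\<forall>s\<in>S. \<forall>t\<in>S. s \<noteq> t \<longrightarrow> s \<inter> t = {}) \<and>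
     \<Union>S = UNIV \<and>
     (\<exists>T\<subseteq>S. \<Union>T = Id) \<and>
     (\<forall>s\<in>S. s\<inverse> \<in> S) \<and>
     (\<forall>r\<in>S. \<forall>s\<in>S. \<forall>t\<in>S. \<forall>p\<in>t. \<forall>q\<in>t.
        card {b. (fst p, b) \<in> r \<and> (b, snd p) \<in> s} =
        card {b. (fst q, b) \<in> r \<and> (b, snd q) \<in> s})"

definition scheme :: "('n::finite \<times> 'n) set set \<Rightarrow> bool" where
  "scheme S \<longleftrightarrow> coherent_config S \<and> Id \<in> S"

definition equivalenced :: "('n::finite \<times> 'n) set set \<Rightarrow> nat \<Rightarrow> bool" where
  "equivalenced S k \<longleftrightarrow> (\<forall>s\<in>S - {Id}. \<forall>a. card {b. (a, b) \<in> s} = k)"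

definition inum :: "('n::finite \<times> 'n) set \<Rightarrow> ('n \<times> 'n) set \<Rightarrow> ('n \<times> 'n) set \<Rightarrow> nat" where
  "inum r s t = (let p = (SOME p. p \<in> t) in card {b. (fst p, b) \<in> r \<and> (b, snd p) \<in> s})"

definition cval :: "('n::finite \<times> 'n) set set \<Rightarrow> ('n \<times> 'n) set \<Rightarrow> nat" where
  "cval S s = (\<Sum>t\<in>S. inum t (t\<inverse>) s)"

definition adj :: "('n::finite \<times> 'n) set \<Rightarrow> complex^'n^'n" where
  "adj s = (\<chi> i j. if (i, j) \<in> s then 1 else 0)"

definition cscale :: "complex \<Rightarrow> complex^'n^'m \<Rightarrow> complex^'n^'m" where
  "cscale c M = (\<chi> i j. c * M $ i $ j)"

definition adj_alg :: "('n::finite \<times> 'n) set set \<Rightarrow> (complex^'n^'n) set" where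
  "adj_alg S = {M. \<exists>c. M = (\<Sum>s\<in>S. cscale (c s) (adj s))}"

definition central_idem :: "('n::finite \<times> 'n) set set \<Rightarrow> complex^'n^'n \<Rightarrow> bool" where
  "central_idem S E \<longleftrightarrow> E \<in> adj_alg S \<and> (\<forall>N\<in>adj_alg S. E ** N = N ** E) \<and> E ** E = E"

definition cpi :: "('n::finite \<times> 'n) set set \<Rightarrow> (complex^'n^'n) set" where
  "cpi S = {E. central_idem S E \<and> E \<noteq> 0 \<and>
              (\<forall>F. central_idem S F \<and> F ** E = F \<longrightarrow> F = 0 \<or> F = E)}"

definition P0 :: "complex^'n^'n" where
  "P0 = cscale (1 / of_nat CARD('n)) (\<chi> i j. 1)"

definition cpi_nontriv :: "('n::finite \<times> 'n) set set \<Rightarrow> (complex^'n^'n) set" where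
  "cpi_nontriv S = cpi S - {P0}"

definition submodule :: "('n::finite \<times> 'n) set set \<Rightarrow> (complex^'n) set \<Rightarrow> bool" where
  "submodule S W \<longleftrightarrow> vec.subspace W \<and> (\<forall>A\<in>adj_alg S. \<forall>w\<in>W. A *v w \<in> W)"

definition irred_submodule :: "('n::finite \<times> 'n) set set \<Rightarrow> (complex^'n) set \<Rightarrow> bool" where
  "irred_submodule S W \<longleftrightarrow> submodule S W \<and> W \<noteq> {0} \<and>
     (\<forall>U. submodule S U \<and> U \<subseteq> W \<longrightarrow> U = {0} \<or> U = W)"

text \<open>n_P: dimension of an irreducible submodule corresponding to P (i.e. on which P acts as identity).\<close>
definition nP :: "('n::finite \<times> 'n) set set \<Rightarrow> complex^'n^'n \<Rightarrow> nat" where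
  "nP S P = (SOME d. \<exists>W. irred_submodule S W \<and> (\<forall>w\<in>W. P *v w = w) \<and> d = vec.dim W)"

definition mP :: "('n::finite \<times> 'n) set set \<Rightarrow> complex^'n^'n \<Rightarrow> real" where
  "mP S P = real (rank P) / real (nP S P)"

definition pseudocyclic :: "('n::finite \<times> 'n) set set \<Rightarrow> bool" where
  "pseudocyclic S \<longleftrightarrow> (\<exists>q. \<forall>P\<in>cpi_nontriv S. mP S P / real (nP S P) = q)"

definition commutative_scheme :: "('n::finite \<times> 'n) set set \<Rightarrow> bool" where
  "commutative_scheme S \<longleftrightarrow> (\<forall>A\<in>adj_alg S. \<forall>B\<in>adj_alg S. A ** B = B ** A)"

end

theory Submission
  imports Defs "HOL-Computational_Algebra.Fundamental_Theorem_Algebra"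
begin

text \<open>
  Everything is read off the Casimir element \<open>C = (\<Sum>s\<in>S. A(s) A(s*) / card s)\<close> of the adjacency
  algebra with its trace form.  It is central, and Schur's lemma applied to an irreducible module
  gives \<open>C P = (n\<^sub>P / m\<^sub>P) P\<close> for every central primitive idempotent \<open>P\<close>.  So the scheme is
  pseudocyclic with ratio \<open>q\<close> iff \<open>C = I / q + (1 - 1 / q) P\<^sub>0\<close>, and both sides can be compared
  entrywise.  The diagonal gives \<open>q (card S - 1) = n - 1\<close>, so \<open>q\<close> is the average valency of
  the relations other than the identity; \<open>trace (A(r) C)\<close> is an integer equal to
  \<open>(1 - 1 / q) n\<^sub>r\<close>, so for integral \<open>q = k\<close> each \<open>n\<^sub>r\<close> is a multiple of \<open>k\<close> and hence equal to \<open>k\<close>;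
  the remaining entries then say \<open>c(r) = k - 1\<close>.

  If moreover \<open>n\<^sub>P = d\<close> for all nontrivial \<open>P\<close>, then all \<open>m\<^sub>P\<close> equal \<open>m = q d\<close>, and
  \<open>0 = trace A(r) = n\<^sub>r + m t\<close> where \<open>t\<close> is a sum of irreducible character values, i.e. an algebraic
  integer.  Hence \<open>n\<^sub>r \<ge> q d\<close>, and comparison with the average valency \<open>q\<close> forces \<open>d = 1\<close>.
\<close>

section \<open>Matrices over the complex numbers\<close>

lemma cscale_nth [simp]: "cscale c M $ i $ j = c * M $ i $ j"
  by (simp add: cscale_def)

lemma cscale_simps [simp]:
  "cscale 1 M = M" "cscale 0 M = 0" "cscale c 0 = 0"
  "cscale c (cscale d M) = cscale (c * d) M"
  by (simp_all add: vec_eq_iff mult.assoc)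

lemma cscale_add_left: "cscale (c + d) M = cscale c M + cscale d M"
  and cscale_sum: "cscale c (\<Sum>x\<in>X. f x) = (\<Sum>x\<in>X. cscale c (f x))"
  and cscale_sum_left: "cscale (\<Sum>x\<in>X. g x) M = (\<Sum>x\<in>X. cscale (g x) M)"
  by (simp_all add: vec_eq_iff algebra_simps sum_distrib_left sum_distrib_right)

lemma cscale_mult_left [simp]: "cscale c M ** N = cscale c (M ** N)"
  and cscale_mult_right [simp]: "M ** cscale c N = cscale c (M ** N)"
  by (simp_all add: vec_eq_iff matrix_matrix_mult_def sum_distrib_left mult_ac)

lemma cscale_mult_vec: "cscale c M *v v = c *s (M *v v)"
  by (simp add: vec_eq_iff matrix_vector_mult_def sum_distrib_left mult_ac)

lemma cscale_eq_iff: "M \<noteq> 0 \<Longrightarrow> cscale c M = cscale d M \<longleftrightarrow> c = d"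
  by (auto simp: vec_eq_iff)

lemma matrix_mult_diff_left: "(A - B) ** C = A ** C - B ** C"
  and matrix_mult_diff_right: "A ** (B - C) = A ** B - A ** C"
  for A B C :: "complex^'n^'n"
  by (simp_all add: vec_eq_iff matrix_matrix_mult_def algebra_simps sum_subtractf)

lemma matrix_mult_add_left: "(A + B) ** C = A ** C + B ** C"
  and matrix_mult_add_right: "A ** (B + C) = A ** B + A ** C"
  for A B C :: "complex^'n^'n"
  by (simp_all add: vec_eq_iff matrix_matrix_mult_def algebra_simps sum.distrib)

lemma matrix_mult_0 [simp]: "0 ** A = 0" "A ** 0 = 0" for A :: "complex^'n^'n"
  by (simp_all add: vec_eq_iff matrix_matrix_mult_def)

lemma matrix_mult_sum_left: "(\<Sum>x\<in>X. f x) ** C = (\<Sum>x\<in>X. f x ** C)"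
  for C :: "complex^'n^'n" and f :: "_ \<Rightarrow> complex^'n^'n"
  by (induction X rule: infinite_finite_induct) (simp_all add: matrix_mult_add_left)

lemma matrix_mult_sum_right: "C ** (\<Sum>x\<in>X. f x) = (\<Sum>x\<in>X. C ** f x)"
  for C :: "complex^'n^'n" and f :: "_ \<Rightarrow> complex^'n^'n"
  by (induction X rule: infinite_finite_induct) (simp_all add: matrix_mult_add_right)

lemma trace_cscale: "trace (cscale c M) = c * trace M"
  by (simp add: trace_def sum_distrib_left)

lemma trace_diff: "trace (A - B) = trace A - trace B"
  and trace_plus: "trace (A + B) = trace A + trace B" for A B :: "complex^'n^'n"
  by (simp_all add: trace_def sum_subtractf sum.distrib)

lemma trace_sum: "trace (\<Sum>x\<in>X. f x) = (\<Sum>x\<in>X. trace (f x))" for f :: "_ \<Rightarrow> complex^'n^'n"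
  unfolding trace_def by (simp add: sum.swap[of _ X])

lemma trace_mult: "trace (A ** B) = (\<Sum>i\<in>UNIV. \<Sum>j\<in>UNIV. A $ i $ j * B $ j $ i)"
  by (simp add: trace_def matrix_matrix_mult_def)

lemma trace_mult_commute: "trace (A ** B) = trace (B ** A)" for A B :: "complex^'n^'n"
  by (rule trace_mul_sym)

lemma matrix_eqI_vec: "(\<And>v. A *v v = B *v v) \<Longrightarrow> A = B" for A B :: "complex^'n^'n"
  by (simp add: matrix_eq)

lemma subspace_range_mult_vec:
  "vec.subspace (range ((*v) A))" for A :: "complex^'n^'n"
  by (metis vec.linear_subspace_image matrix_vector_mul_linear_gen vec.subspace_UNIV)

lemma idempotent_vec: "E ** E = E \<Longrightarrow> E *v (E *v v) = E *v v" for E :: "complex^'n^'n"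
  by (simp add: matrix_vector_mul_assoc)

lemma mult_vec_axis: "A *v axis j 1 = column j A" for A :: "complex^'n^'n"
  by (simp add: vec_eq_iff column_def matrix_vector_mult_def axis_def if_distrib cong: if_cong)

section \<open>Projections onto subspaces and traces of idempotents\<close>

text \<open>A linear left inverse of the identity on \<open>W\<close>, with values in
  \<open>W\<close>, is such a projection. It turns the character of a submodule into the trace of a
  matrix product.\<close>

lemma ex_projection:
  assumes "vec.subspace (W :: (complex^'n) set)"
  shows "\<exists>H :: complex^'n^'n. H ** H = H \<and> range ((*v) H) = W"
proof -
  have "Vector_Spaces.linear (*s) (*s) (\<lambda>x::complex^'n. x)"
    using vec.linear_id unfolding id_def .
  from vec.linear_exists_left_inverse_on[OF this assms]
  obtain g where g: "range g \<subseteq> W" "Vector_Spaces.linear (*s) (*s) g" "\<forall>v\<in>W. g v = v"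
    by auto
  have 1: "matrix g *v v = g v" for v using matrix_works[OF g(2)] .
  show ?thesis
  proof (intro exI conjI)
    show "matrix g ** matrix g = matrix g"
      by (rule matrix_eqI_vec)
        (use g(1,3) in \<open>simp add: 1 image_subset_iff flip: matrix_vector_mul_assoc\<close>)
    have "w \<in> range g" if "w \<in> W" for w using g(3) that by (metis rangeI)
    then show "range ((*v) (matrix g)) = W" using g(1) by (auto simp: 1 fun_eq_iff)
  qed
qed

text \<open>Expanding \<open>H *v v\<close> in a basis \<open>B\<close> of the range and exchanging
  sums turns the trace into the sum over \<open>w\<close> in \<open>B\<close> of the
  \<open>w\<close>-coordinate of \<open>H *v w\<close>. Each is 1 because \<open>H\<close> fixes its
  range.\<close>

lemma trace_idempotent:
  fixes H :: "complex^'n^'n"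
  assumes "H ** H = H"
  shows "trace H = of_nat (vec.dim (range ((*v) H)))"
proof -
  let ?W = "range ((*v) H)"
  have sub: "vec.subspace ?W" by (rule subspace_range_mult_vec)
  obtain B where B: "B \<subseteq> ?W" "vec.independent B" "?W \<subseteq> vec.span B" "card B = vec.dim ?W"
    using vec.basis_exists by blast
  have fin: "finite B" using vec.finiteI_independent[OF B(2)] .
  have span: "vec.span B = ?W" using B sub by (metis vec.span_subspace)
  define r where "r v w = vec.representation B (H *v v) w" for v w
  have lin_add: "r (u + v) w = r u w + r v w" for u v w
    unfolding r_def matrix_vector_right_distrib
    by (subst vec.representation_add) (use B span in auto)
  have lin_sc: "r (c *s v) w = c * r v w" for c v w
    unfolding r_def vec.scale
    by (subst vec.representation_scale) (use B span in \<open>auto simp: vector_scalar_commute[symmetric]\<close>)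
  have r0: "r 0 w = 0" for w using lin_sc[of 0 0 w] by simp
  have rsum: "r (\<Sum>j\<in>J. f j) w = (\<Sum>j\<in>J. r (f j) w)" for J :: "'n set" and f w
    by (induction J rule: infinite_finite_induct) (simp_all add: r0 lin_add)
  have Hv: "H *v v = (\<Sum>w\<in>B. r v w *s w)" for v
    unfolding r_def
    by (rule vec.sum_representation_eq[symmetric]) (use B fin span in auto)
  have "trace H = (\<Sum>j\<in>UNIV. (H *v axis j 1) $ j)"
    by (simp add: trace_def mult_vec_axis column_def)
  also have "\<dots> = (\<Sum>j\<in>UNIV. \<Sum>w\<in>B. r (axis j 1) w * w $ j)"
    by (simp add: Hv)
  also have "\<dots> = (\<Sum>w\<in>B. \<Sum>j\<in>UNIV. r ((w $ j) *s axis j 1) w)"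
    by (subst sum.swap) (simp add: lin_sc mult.commute)
  also have "\<dots> = (\<Sum>w\<in>B. r w w)"
    by (simp add: rsum[symmetric] basis_expansion)
  also have "\<dots> = (\<Sum>w\<in>B. 1)"
  proof (rule sum.cong[OF refl])
    fix w assume w: "w \<in> B"
    then obtain x where "w = H *v x" using B by auto
    then have "H *v w = w" using idempotent_vec[OF assms] by simp
    then show "r w w = 1"
      unfolding r_def using vec.representation_basis[OF B(2) w] by simp
  qed
  finally show ?thesis using B by simp
qed

text \<open>\<open>rank\<close> unfolds to the dimension of the row space, which is the range of the
  transpose; hence the trace formula is applied to \<open>transpose H\<close>.\<close>

lemma rank_idempotent:
  fixes H :: "complex^'n^'n"
  assumes "H ** H = H"
  shows "of_nat (rank H) = trace H"
proof -
  have "transpose H ** transpose H = transpose H"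
    using assms by (metis matrix_transpose_mul)
  from trace_idempotent[OF this]
  have "trace H = of_nat (vec.dim (range ((*v) (transpose H))))"
    by (simp add: trace_def transpose_def)
  moreover have "range ((*v) (transpose H)) = vec.span (rows H)"
  proof -
    have "range ((*v) (transpose H)) \<subseteq> vec.span (columns (transpose H))"
      using matrix_vector_mult_in_columnspace_gen by blast
    moreover have "columns (transpose H) \<subseteq> range ((*v) (transpose H))"
    proof
      fix c assume "c \<in> columns (transpose H)"
      then obtain j where "c = column j (transpose H)" by (auto simp: columns_def)
      then have "c = transpose H *v axis j 1" by (simp only: mult_vec_axis)
      then show "c \<in> range ((*v) (transpose H))" by blast
    qed
    ultimately show ?thesis
      using vec.span_minimal[OF _ subspace_range_mult_vec[of "transpose H"]]
      by (simp del: transpose_matrix_vector) blast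
  qed
  ultimately show ?thesis by (simp add: row_rank_def_gen)
qed

section \<open>Polynomials in a matrix and eigenvectors\<close>

text \<open>This is p(M) v by Horner's rule, kept at the level of vectors so that no matrix powers
  appear.\<close>

definition poly_act :: "complex^'n^'n \<Rightarrow> complex poly \<Rightarrow> complex^'n \<Rightarrow> complex^'n" where
  "poly_act M p v = fold_coeffs (\<lambda>a w. a *s v + M *v w) p 0"

lemma poly_act_0 [simp]: "poly_act M 0 v = 0"
  by (simp add: poly_act_def)

lemma poly_act_pCons [simp]: "poly_act M (pCons a p) v = a *s v + M *v poly_act M p v"
  by (cases "a = 0 \<and> p = 0") (auto simp: poly_act_def)

lemma poly_act_add: "poly_act M (p + q) v = poly_act M p v + poly_act M q v"
proof (induction p arbitrary: q)
  case (pCons a p)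
  obtain b r where "q = pCons b r" by (rule pCons_cases)
  then show ?case
    by (simp add: pCons.IH algebra_simps vec.scale_left_distrib)
qed simp

lemma poly_act_smult: "poly_act M (smult c p) v = c *s poly_act M p v"
  by (induction p) (simp_all add: vec.scale_right_distrib vec.scale)

lemma poly_act_diff: "poly_act M (p - q) v = poly_act M p v - poly_act M q v"
  using poly_act_add[of M "p - q" q v] by simp

lemma poly_act_sum: "poly_act M (\<Sum>x\<in>X. f x) v = (\<Sum>x\<in>X. poly_act M (f x) v)"
  by (induction X rule: infinite_finite_induct) (simp_all add: poly_act_add)

lemma poly_act_linear_factor:
  "poly_act M ([:-a, 1:] * q) v = M *v poly_act M q v - a *s poly_act M q v"
  by (simp add: poly_act_diff poly_act_smult)

lemma poly_act_in_subspace: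
  assumes "vec.subspace U" "\<And>u. u \<in> U \<Longrightarrow> M *v u \<in> U" "v \<in> U"
  shows "poly_act M p v \<in> U"
  by (induction p) (use assms in \<open>auto intro: vec.subspace_add vec.subspace_scale vec.subspace_0\<close>)

text \<open>The \<open>CARD('n) + 1\<close> vectors M^i v are linearly dependent. A repetition among
  them is treated apart, since dependence of the image set does not record it.\<close>

lemma ex_annihilating_poly:
  fixes M :: "complex^'n^'n"
  shows "\<exists>p. p \<noteq> 0 \<and> poly_act M p v = 0"
proof -
  define x where "x i = poly_act M (monom 1 i) v" for i
  show ?thesis
  proof (cases "inj_on x {..CARD('n)}")
    case False
    then obtain i j where ij: "i \<noteq> j" "x i = x j" by (auto simp: inj_on_def)
    have "poly_act M (monom 1 i - monom 1 j) v = 0"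
      using ij by (simp add: poly_act_diff x_def)
    moreover have "monom 1 i - monom 1 j \<noteq> (0 :: complex poly)"
      using ij by (simp add: monom_eq_iff')
    ultimately show ?thesis by blast
  next
    case True
    have "vec.dim (x ` {..CARD('n)}) < card (x ` {..CARD('n)})"
      using vec.dim_subset[of "x ` {..CARD('n)}" UNIV] True
      by (simp add: card_image vec_dim_card del: vec.dim_UNIV)
    then have "vec.dependent (x ` {..CARD('n)})"
      using vec.dependent_biggerset_general by blast
    then obtain u where u: "(\<Sum>w\<in>x ` {..CARD('n)}. u w *s w) = 0" "\<exists>w\<in>x ` {..CARD('n)}. u w \<noteq> 0"
      using vec.dependent_finite[of "x ` {..CARD('n)}"] by auto
    define p where "p = (\<Sum>i\<le>CARD('n). smult (u (x i)) (monom 1 i))"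
    have "poly_act M p v = 0"
      using u(1) unfolding sum.reindex[OF True]
      by (simp add: p_def poly_act_sum poly_act_smult x_def del: smult_monom)
    moreover obtain i where i: "i \<le> CARD('n)" "u (x i) \<noteq> 0" using u(2) by auto
    have "coeff p i = u (x i)"
      using i by (simp add: p_def coeff_sum mult_delta_right)
    then have "p \<noteq> 0" using i by auto
    ultimately show ?thesis by blast
  qed
qed

text \<open>Induction on the degree of an annihilating polynomial (X - a) q: the vector q(M) v is
  either 0, which lowers the degree, or an eigenvector for \<open>a\<close>, which stays in the
  invariant subspace \<open>U\<close>.\<close>

lemma ex_eigenvector_in_subspace:
  fixes M :: "complex^'n^'n"
  assumes U: "vec.subspace U" "\<And>u. u \<in> U \<Longrightarrow> M *v u \<in> U" and v: "v \<in> U" "v \<noteq> 0"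
  shows "\<exists>a u. u \<in> U \<and> u \<noteq> 0 \<and> M *v u = a *s u"
proof -
  have "\<exists>a u. u \<in> U \<and> u \<noteq> 0 \<and> M *v u = a *s u" if "p \<noteq> 0" "poly_act M p v = 0" for p
    using that
  proof (induction "degree p" arbitrary: p)
    case 0
    then obtain c where "p = [:c:]" by (metis degree_eq_zeroE)
    with 0 v show ?case by simp
  next
    case (Suc n)
    then obtain a where "poly p a = 0"
      by (metis fundamental_theorem_of_algebra constant_degree nat.distinct(1))
    then obtain q where q: "p = [:-a, 1:] * q" by (metis poly_eq_0_iff_dvd dvd_def)
    then have "q \<noteq> 0" using Suc.prems by auto
    then have deg: "n = degree q" using Suc.hyps(2) unfolding q by (subst (asm) degree_mult_eq) auto
    show ?case
    proof (cases "poly_act M q v = 0")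
      case True
      then show ?thesis using Suc.hyps(1)[OF deg \<open>q \<noteq> 0\<close>] by simp
    next
      case False
      have "M *v poly_act M q v = a *s poly_act M q v"
        using Suc.prems(2) unfolding q poly_act_linear_factor by simp
      then show ?thesis using False poly_act_in_subspace[OF U v(1)] by blast
    qed
  qed
  then show ?thesis using ex_annihilating_poly by blast
qed

section \<open>The adjacency algebra of a scheme and its Casimir element\<close>

definition ctranspose :: "complex^'n^'n \<Rightarrow> complex^'n^'n" where
  "ctranspose M = (\<chi> i j. cnj (M $ j $ i))"

lemma ctranspose_ctranspose [simp]: "ctranspose (ctranspose M) = M"
  by (simp add: ctranspose_def vec_eq_iff)

lemma ctranspose_mult: "ctranspose (A ** B) = ctranspose B ** ctranspose A"
  by (simp add: ctranspose_def vec_eq_iff matrix_matrix_mult_def mult.commute)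

text \<open>Positivity: the diagonal entries of the product are the squared norms of the columns of
  \<open>M\<close>.\<close>

lemma ctranspose_mult_self_eq_0:
  assumes "ctranspose M ** M = 0"
  shows "M = 0"
proof -
  have "M $ i $ j = 0" for i j
  proof -
    have "0 = (ctranspose M ** M) $ j $ j" using assms by simp
    also have "\<dots> = (\<Sum>k\<in>UNIV. complex_of_real ((cmod (M $ k $ j))\<^sup>2))"
      by (simp add: ctranspose_def matrix_matrix_mult_def complex_norm_square mult.commute del: of_real_power)
    finally have "(\<Sum>k\<in>UNIV. (cmod (M $ k $ j))\<^sup>2) = 0"
      by (metis of_real_eq_0_iff of_real_sum)
    then show ?thesis by (simp add: sum_nonneg_eq_0_iff)
  qed
  then show ?thesis by (simp add: vec_eq_iff)
qed

lemma adj_nth [simp]: "adj s $ i $ j = (if (i, j) \<in> s then 1 else 0)"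
  by (simp add: adj_def)

lemma adj_Id: "adj Id = mat 1"
  by (simp add: vec_eq_iff mat_def)

lemma adj_mult_nth: "(adj r ** adj s) $ a $ c = of_nat (card {b. (a, b) \<in> r \<and> (b, c) \<in> s})"
proof -
  have "(adj r ** adj s) $ a $ c = (\<Sum>b\<in>UNIV. if (a, b) \<in> r \<and> (b, c) \<in> s then 1 else 0)"
    by (auto simp: matrix_matrix_mult_def intro!: sum.cong)
  then show ?thesis by (simp add: sum.If_cases)
qed

lemma trace_mult_adj_converse: "trace (Z ** adj (t\<inverse>)) = (\<Sum>p\<in>t. Z $ fst p $ snd p)"
proof -
  have "trace (Z ** adj (t\<inverse>)) = (\<Sum>i\<in>UNIV. \<Sum>j\<in>UNIV. if (i, j) \<in> t then Z $ i $ j else 0)"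
    unfolding trace_mult by (intro sum.cong refl) simp
  also have "\<dots> = (\<Sum>p\<in>UNIV. if p \<in> t then Z $ fst p $ snd p else 0)"
    by (simp add: sum.cartesian_product case_prod_beta)
  finally show ?thesis by (simp add: sum.If_cases)
qed

text \<open>The image of \<open>Y\<close> under the Casimir element of the adjacency algebra for the trace form:
  with respect to that form, the bases \<open>adj s\<close> and \<open>adj (s\<inverse>) / card s\<close> are dual.\<close>

definition casimir :: "('n::finite \<times> 'n) set set \<Rightarrow> complex^'n^'n \<Rightarrow> complex^'n^'n" where
  "casimir S Y = (\<Sum>s\<in>S. cscale (1 / of_nat (card s)) (adj s ** Y ** adj (s\<inverse>)))"

definition central :: "('n::finite \<times> 'n) set set \<Rightarrow> complex^'n^'n \<Rightarrow> bool" where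
  "central S Z \<longleftrightarrow> Z \<in> adj_alg S \<and> (\<forall>X\<in>adj_alg S. Z ** X = X ** Z)"

lemma central_idem_iff: "central_idem S E \<longleftrightarrow> central S E \<and> E ** E = E"
  by (auto simp: central_idem_def central_def)

locale assoc_scheme =
  fixes S :: "('n::finite \<times> 'n) set set"
  assumes scheme: "scheme S"
begin

lemma
  shows Id_mem: "Id \<in> S"
    and relation_nonempty: "\<And>s. s \<in> S \<Longrightarrow> s \<noteq> {}"
    and relations_eq: "\<And>s t p. s \<in> S \<Longrightarrow> t \<in> S \<Longrightarrow> p \<in> s \<Longrightarrow> p \<in> t \<Longrightarrow> s = t"
    and relation_ex: "\<And>p. \<exists>s\<in>S. p \<in> s"
    and converse_mem: "\<And>s. s \<in> S \<Longrightarrow> s\<inverse> \<in> S"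
    and card_paths_eq: "\<And>r s t a c a' c'. r \<in> S \<Longrightarrow> s \<in> S \<Longrightarrow> t \<in> S \<Longrightarrow> (a, c) \<in> t \<Longrightarrow> (a', c') \<in> t \<Longrightarrow>
      card {b. (a, b) \<in> r \<and> (b, c) \<in> s} = card {b. (a', b) \<in> r \<and> (b, c') \<in> s}"
proof -
  have cc: "coherent_config S" and Id: "Id \<in> S" using scheme by (auto simp: scheme_def)
  show "Id \<in> S" by fact
  note cc = cc[unfolded coherent_config_def]
  show "\<And>s. s \<in> S \<Longrightarrow> s \<noteq> {}" using cc[THEN conjunct1] by blast
  show "\<And>s t p. s \<in> S \<Longrightarrow> t \<in> S \<Longrightarrow> p \<in> s \<Longrightarrow> p \<in> t \<Longrightarrow> s = t"
    using cc[THEN conjunct2, THEN conjunct1] by blast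
  have "\<Union>S = UNIV" using cc by (elim conjE)
  then show "\<And>p. \<exists>s\<in>S. p \<in> s" by blast
  have "\<forall>s\<in>S. s\<inverse> \<in> S" using cc by (elim conjE)
  then show "\<And>s. s \<in> S \<Longrightarrow> s\<inverse> \<in> S" by blast
  fix r s t a c a' c' assume *: "r \<in> S" "s \<in> S" "t \<in> S" "(a, c) \<in> t" "(a', c') \<in> t"
  have "\<forall>r\<in>S. \<forall>s\<in>S. \<forall>t\<in>S. \<forall>p\<in>t. \<forall>q\<in>t.
        card {b. (fst p, b) \<in> r \<and> (b, snd p) \<in> s} =
        card {b. (fst q, b) \<in> r \<and> (b, snd q) \<in> s}"
    using cc by (elim conjE)
  from this[rule_format, OF *] 
  show "card {b. (a, b) \<in> r \<and> (b, c) \<in> s} = card {b. (a', b) \<in> r \<and> (b, c') \<in> s}"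
    by simp
qed

lemma finite_S [simp]: "finite S"
  by (rule finite)

lemma card_relation_pos: "s \<in> S \<Longrightarrow> card s > 0"
  using relation_nonempty[of s] by (simp add: card_gt_0_iff)

lemma sum_over_class:
  assumes "s \<in> S" "p \<in> s"
  shows "(\<Sum>t\<in>S. if p \<in> t then f t else 0) = f s"
proof -
  have "(\<Sum>t\<in>S. if p \<in> t then f t else 0) = (\<Sum>t\<in>S. if t = s then f t else 0)"
    using assms relations_eq by (intro sum.cong) auto
  then show ?thesis using assms by simp
qed

lemma sum_cscale_adj_nth:
  assumes "s \<in> S" "(a, b) \<in> s"
  shows "(\<Sum>t\<in>S. cscale (f t) (adj t)) $ a $ b = f s"
proof -
  have "(\<Sum>t\<in>S. cscale (f t) (adj t)) $ a $ b = (\<Sum>t\<in>S. if (a, b) \<in> t then f t else 0)"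
    by (auto simp: intro!: sum.cong)
  then show ?thesis using sum_over_class[OF assms] by simp
qed

text \<open>The relations partition all pairs, so the coefficient of \<open>adj s\<close> is the
  entry at any pair in \<open>s\<close>.\<close>

lemma adj_alg_iff:
  "M \<in> adj_alg S \<longleftrightarrow> (\<forall>s\<in>S. \<forall>p\<in>s. \<forall>q\<in>s. M $ fst p $ snd p = M $ fst q $ snd q)"
proof
  assume "M \<in> adj_alg S"
  then obtain c where "M = (\<Sum>s\<in>S. cscale (c s) (adj s))" by (auto simp: adj_alg_def)
  then have "M $ a $ b = c s" if "s \<in> S" "(a, b) \<in> s" for s a b
    using sum_cscale_adj_nth[OF that] by simp
  then show "\<forall>s\<in>S. \<forall>p\<in>s. \<forall>q\<in>s. M $ fst p $ snd p = M $ fst q $ snd q"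
    by (simp add: split_paired_all)
next
  assume *: "\<forall>s\<in>S. \<forall>p\<in>s. \<forall>q\<in>s. M $ fst p $ snd p = M $ fst q $ snd q"
  define c where "c s = (let p = (SOME p. p \<in> s) in M $ fst p $ snd p)" for s :: "('n \<times> 'n) set"
  have "M $ a $ b = (\<Sum>s\<in>S. cscale (c s) (adj s)) $ a $ b" for a b
  proof -
    obtain s where s: "s \<in> S" "(a, b) \<in> s" using relation_ex by blast
    have "(SOME p. p \<in> s) \<in> s" using s(2) by (rule someI)
    then have "c s = M $ a $ b" using *[rule_format, OF s(1) _ s(2)] by (simp add: c_def Let_def)
    then show ?thesis using sum_cscale_adj_nth[OF s] by simp
  qed
  then have "M = (\<Sum>s\<in>S. cscale (c s) (adj s))" by (simp only: vec_eq_iff) blast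
  then show "M \<in> adj_alg S" unfolding adj_alg_def by blast
qed

lemma adj_alg_nth_eq:
  "M \<in> adj_alg S \<Longrightarrow> s \<in> S \<Longrightarrow> (a, b) \<in> s \<Longrightarrow> (c, d) \<in> s \<Longrightarrow> M $ a $ b = M $ c $ d"
  using adj_alg_iff[THEN iffD1, rule_format, of M s "(a, b)" "(c, d)"] by simp

lemma adj_algI:
  assumes "\<And>s a b c d. s \<in> S \<Longrightarrow> (a, b) \<in> s \<Longrightarrow> (c, d) \<in> s \<Longrightarrow> M $ a $ b = M $ c $ d"
  shows "M \<in> adj_alg S"
  unfolding adj_alg_iff using assms by (simp add: split_paired_all)

lemma adj_alg_0 [simp]: "0 \<in> adj_alg S"
  by (rule adj_algI) simp

lemma adj_alg_add: "M \<in> adj_alg S \<Longrightarrow> N \<in> adj_alg S \<Longrightarrow> M + N \<in> adj_alg S"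
  by (rule adj_algI) (metis adj_alg_nth_eq vector_add_component)

lemma adj_alg_diff: "M \<in> adj_alg S \<Longrightarrow> N \<in> adj_alg S \<Longrightarrow> M - N \<in> adj_alg S"
  by (rule adj_algI) (metis adj_alg_nth_eq vector_minus_component)

lemma adj_alg_cscale: "M \<in> adj_alg S \<Longrightarrow> cscale c M \<in> adj_alg S"
  by (rule adj_algI) (metis adj_alg_nth_eq cscale_nth)

lemma adj_alg_sum: "(\<And>x. x \<in> X \<Longrightarrow> f x \<in> adj_alg S) \<Longrightarrow> (\<Sum>x\<in>X. f x) \<in> adj_alg S"
  by (induction X rule: infinite_finite_induct) (simp_all add: adj_alg_add)

lemma adj_mem: "s \<in> S \<Longrightarrow> adj s \<in> adj_alg S"
  by (rule adj_algI) (metis adj_nth relations_eq)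

lemma mat_1_mem: "mat 1 \<in> adj_alg S"
  using adj_mem[OF Id_mem] by (simp add: adj_Id)

lemma adj_mult_adj_mem: "r \<in> S \<Longrightarrow> s \<in> S \<Longrightarrow> adj r ** adj s \<in> adj_alg S"
  by (rule adj_algI) (simp only: adj_mult_nth, rule arg_cong[of _ _ of_nat], rule card_paths_eq)

lemma adj_alg_mult:
  assumes "M \<in> adj_alg S" "N \<in> adj_alg S"
  shows "M ** N \<in> adj_alg S"
proof -
  obtain c d where "M = (\<Sum>s\<in>S. cscale (c s) (adj s))" "N = (\<Sum>s\<in>S. cscale (d s) (adj s))"
    using assms by (auto simp: adj_alg_def)
  then show ?thesis
    by (auto simp: matrix_mult_sum_left matrix_mult_sum_right
        intro!: adj_alg_sum adj_alg_cscale adj_mult_adj_mem)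
qed

lemma ctranspose_mem:
  assumes "M \<in> adj_alg S"
  shows "ctranspose M \<in> adj_alg S"
proof (rule adj_algI)
  fix s a b c d assume "s \<in> S" "(a, b) \<in> s" "(c, d) \<in> s"
  then show "ctranspose M $ a $ b = ctranspose M $ c $ d"
    using adj_alg_nth_eq[OF assms converse_mem[of s], of b a d c] by (simp add: ctranspose_def)
qed

lemma trace_mult_adj_converse_eq:
  assumes "Z \<in> adj_alg S" "t \<in> S" "(a, b) \<in> t"
  shows "trace (Z ** adj (t\<inverse>)) = of_nat (card t) * Z $ a $ b"
proof -
  have "(\<Sum>p\<in>t. Z $ fst p $ snd p) = (\<Sum>p\<in>t. Z $ a $ b)"
    by (intro sum.cong refl) (metis adj_alg_nth_eq assms prod.collapse)
  then show ?thesis by (simp add: trace_mult_adj_converse)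
qed

text \<open>Pairing with \<open>adj (t\<inverse>)\<close> sums the entries over \<open>t\<close>,
  where they are constant, and so returns \<open>card t\<close> times the coefficient of
  \<open>adj t\<close>.\<close>

lemma adj_alg_expansion:
  assumes "Z \<in> adj_alg S"
  shows "Z = (\<Sum>t\<in>S. cscale (trace (Z ** adj (t\<inverse>)) / of_nat (card t)) (adj t))"
    (is "_ = ?R")
proof -
  have "Z $ a $ b = ?R $ a $ b" for a b
  proof -
    obtain t where t: "t \<in> S" "(a, b) \<in> t" using relation_ex by blast
    show ?thesis
      using trace_mult_adj_converse_eq[OF assms t] relation_nonempty[OF t(1)]
      unfolding sum_cscale_adj_nth[OF t] by simp
  qed
  then show ?thesis by (simp only: vec_eq_iff) blast
qed

text \<open>Nondegeneracy of the trace form: the coefficients in the expansion are traces of this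
  kind.\<close>

lemma adj_alg_eq_0:
  assumes "Z \<in> adj_alg S" "\<And>X. X \<in> adj_alg S \<Longrightarrow> trace (Z ** X) = 0"
  shows "Z = 0"
  by (subst adj_alg_expansion[OF assms(1)]) (simp add: assms(2) adj_mem converse_mem)

lemma adj_alg_eqI:
  assumes "Y \<in> adj_alg S" "Z \<in> adj_alg S"
    and "\<And>X. X \<in> adj_alg S \<Longrightarrow> trace (Y ** X) = trace (Z ** X)"
  shows "Y = Z"
  using adj_alg_eq_0[of "Y - Z"] assms by (simp add: adj_alg_diff matrix_mult_diff_left trace_diff)

lemma sum_converse: "(\<Sum>s\<in>S. f (s\<inverse>)) = (\<Sum>s\<in>S. f s)"
  by (rule sum.reindex_bij_witness[of _ converse converse]) (auto simp: converse_mem)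

lemma adj_alg_expansion_converse:
  assumes "Z \<in> adj_alg S"
  shows "Z = (\<Sum>t\<in>S. cscale (trace (Z ** adj t) / of_nat (card t)) (adj (t\<inverse>)))"
proof -
  have "Z = (\<Sum>t\<in>S. cscale (trace (Z ** adj ((t\<inverse>)\<inverse>)) / of_nat (card (t\<inverse>))) (adj (t\<inverse>)))"
    unfolding sum_converse[of "\<lambda>t. cscale (trace (Z ** adj (t\<inverse>)) / of_nat (card t)) (adj t)"]
    by (rule adj_alg_expansion[OF assms])
  then show ?thesis by simp
qed

text \<open>\<open>X ** adj s\<close> is expanded in the basis and
  \<open>adj (t\<inverse>) ** X\<close> in the dual one; cyclicity of the trace gives both the
  coefficients \<open>w\<close>. The matrix \<open>Y\<close> is arbitrary because later choices of
  it need not lie in the algebra.\<close>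

lemma casimir_commute:
  assumes X: "X \<in> adj_alg S"
  shows "X ** casimir S Y = casimir S Y ** X"
proof -
  define w where "w s t = trace (X ** adj s ** adj (t\<inverse>)) / (of_nat (card s) * of_nat (card t))"
    for s t :: "('n \<times> 'n) set"
  have "X ** casimir S Y = (\<Sum>s\<in>S. cscale (1 / of_nat (card s)) ((X ** adj s) ** (Y ** adj (s\<inverse>))))"
    by (simp add: casimir_def matrix_mult_sum_right matrix_mul_assoc)
  also have "\<dots> = (\<Sum>s\<in>S. \<Sum>t\<in>S. cscale (w s t) (adj t ** (Y ** adj (s\<inverse>))))"
  proof (rule sum.cong[OF refl])
    fix s assume "s \<in> S"
    then have "X ** adj s \<in> adj_alg S" using X adj_mem adj_alg_mult by blast
    from arg_cong[OF adj_alg_expansion[OF this], of "\<lambda>Z. cscale (1 / of_nat (card s)) (Z ** (Y ** adj (s\<inverse>)))"]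
    show "cscale (1 / of_nat (card s)) ((X ** adj s) ** (Y ** adj (s\<inverse>))) =
      (\<Sum>t\<in>S. cscale (w s t) (adj t ** (Y ** adj (s\<inverse>))))"
      by (simp add: matrix_mult_sum_left cscale_sum w_def)
  qed
  finally have 1: "X ** casimir S Y = (\<Sum>s\<in>S. \<Sum>t\<in>S. cscale (w s t) (adj t ** (Y ** adj (s\<inverse>))))" .
  have "casimir S Y ** X = (\<Sum>t\<in>S. cscale (1 / of_nat (card t)) ((adj t ** Y) ** (adj (t\<inverse>) ** X)))"
    by (simp add: casimir_def matrix_mult_sum_left matrix_mul_assoc)
  also have "\<dots> = (\<Sum>t\<in>S. \<Sum>s\<in>S. cscale (w s t) ((adj t ** Y) ** adj (s\<inverse>)))"
  proof (rule sum.cong[OF refl])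
    fix t assume "t \<in> S"
    then have mem: "adj (t\<inverse>) ** X \<in> adj_alg S" using X adj_mem converse_mem adj_alg_mult by blast
    have tr: "trace (adj (t\<inverse>) ** X ** adj s) = trace (X ** adj s ** adj (t\<inverse>))" for s
      by (metis matrix_mul_assoc trace_mult_commute)
    show "cscale (1 / of_nat (card t)) ((adj t ** Y) ** (adj (t\<inverse>) ** X)) =
      (\<Sum>s\<in>S. cscale (w s t) ((adj t ** Y) ** adj (s\<inverse>)))"
      using arg_cong[OF adj_alg_expansion_converse[OF mem],
          of "\<lambda>Z. cscale (1 / of_nat (card t)) ((adj t ** Y) ** Z)"]
      by (simp add: matrix_mult_sum_right cscale_sum w_def tr mult.commute)
  qed
  finally show ?thesis unfolding 1 by (subst sum.swap) (simp add: matrix_mul_assoc)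
qed

lemma casimir_central: "central S (casimir S (mat 1))"
  unfolding central_def
proof (intro conjI ballI)
  show "casimir S (mat 1) \<in> adj_alg S"
    by (auto simp: casimir_def intro!: adj_alg_sum adj_alg_cscale adj_mult_adj_mem converse_mem)
qed (rule casimir_commute[symmetric])

section \<open>The centre of the adjacency algebra\<close>

lemma central_mem: "central S Z \<Longrightarrow> Z \<in> adj_alg S"
  and central_commute: "central S Z \<Longrightarrow> X \<in> adj_alg S \<Longrightarrow> Z ** X = X ** Z"
  by (auto simp: central_def)

lemma centralI:
  "Z \<in> adj_alg S \<Longrightarrow> (\<And>X. X \<in> adj_alg S \<Longrightarrow> Z ** X = X ** Z) \<Longrightarrow> central S Z"
  by (auto simp: central_def)

lemma central_0 [simp]: "central S 0"
  and central_mat_1: "central S (mat 1)"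
  by (auto intro: centralI simp: mat_1_mem)

lemma central_add: "central S Y \<Longrightarrow> central S Z \<Longrightarrow> central S (Y + Z)"
  by (intro centralI adj_alg_add)
    (auto dest: central_mem simp: matrix_mult_add_left matrix_mult_add_right central_commute[of Y] central_commute[of Z])

lemma central_diff: "central S Y \<Longrightarrow> central S Z \<Longrightarrow> central S (Y - Z)"
  by (intro centralI adj_alg_diff)
    (auto dest: central_mem simp: matrix_mult_diff_left matrix_mult_diff_right central_commute[of Y] central_commute[of Z])

lemma central_cscale: "central S Z \<Longrightarrow> central S (cscale c Z)"
  by (intro centralI adj_alg_cscale) (auto dest: central_mem simp: central_commute[of Z])

lemma central_mult: "central S Y \<Longrightarrow> central S Z \<Longrightarrow> central S (Y ** Z)"
proof (intro centralI adj_alg_mult)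
  fix X assume *: "central S Y" "central S Z" "X \<in> adj_alg S"
  have "Y ** Z ** X = Y ** X ** Z"
    using central_commute[OF *(2,3)] by (simp flip: matrix_mul_assoc)
  then show "Y ** Z ** X = X ** (Y ** Z)"
    using central_commute[OF *(1,3)] by (simp add: matrix_mul_assoc)
qed (auto intro: central_mem)

text \<open>The algebra is closed under conjugate transposition, so \<open>Y\<close> commutes with
  \<open>ctranspose Y\<close>. Hence the Hermitian matrix \<open>?G\<close> has square 0, and
  positivity kills first \<open>?G\<close> and then \<open>Y\<close>.\<close>

lemma central_square_0:
  assumes Y: "central S Y" "Y ** Y = 0"
  shows "Y = 0"
proof -
  let ?G = "ctranspose Y ** Y"
  have sym: "ctranspose ?G = ?G"
    by (simp add: ctranspose_mult)
  have "?G ** ?G = ctranspose Y ** (Y ** ctranspose Y) ** Y"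
    by (simp add: matrix_mul_assoc)
  also have "\<dots> = ctranspose Y ** (ctranspose Y ** Y) ** Y"
    using central_commute[OF Y(1) ctranspose_mem[OF central_mem[OF Y(1)]]] by (rule arg_cong)
  also have "\<dots> = ctranspose Y ** ctranspose Y ** (Y ** Y)"
    by (simp add: matrix_mul_assoc)
  finally have "ctranspose ?G ** ?G = 0" unfolding sym Y(2) by simp
  then have "?G = 0" by (rule ctranspose_mult_self_eq_0)
  then show ?thesis by (rule ctranspose_mult_self_eq_0)
qed

end

section \<open>Central primitive idempotents and irreducible characters\<close>

lemma scaleR_eq_cscale: "r *\<^sub>R M = cscale (of_real r) M" for M :: "complex^'n^'n"
  by (simp add: vec_eq_iff scaleR_conv_of_real[where 'a = complex])

lemma idempotent_diff:
  fixes E F :: "complex^'n^'n"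
  assumes "E ** E = E" "F ** F = F" "F ** E = F" "E ** F = F"
  shows "(E - F) ** (E - F) = E - F"
  using assms by (simp add: matrix_mult_diff_left matrix_mult_diff_right)

lemma rank_idempotent_pos:
  fixes E :: "complex^'n^'n"
  assumes "E ** E = E" "E \<noteq> 0"
  shows "rank E > 0"
proof (rule ccontr)
  assume "\<not> rank E > 0"
  then have "trace E = 0" using rank_idempotent[OF assms(1)] by simp
  then have "vec.dim (range ((*v) E)) = 0"
    using trace_idempotent[OF assms(1)] by simp
  then have "range ((*v) E) \<subseteq> {0}" by simp
  then have "E *v v = 0 *v v" for v by auto
  then show False using assms(2) matrix_eqI_vec by blast
qed

definition unit_matrix :: "'n \<Rightarrow> 'n \<Rightarrow> complex^'n^'n" where
  "unit_matrix b j = (\<chi> x y. if x = b \<and> y = j then 1 else 0)"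

lemma mult_unit_matrix_nth: "(A ** unit_matrix b j) $ a $ c = (if c = j then A $ a $ b else 0)"
  by (simp add: matrix_matrix_mult_def unit_matrix_def mult_delta_right)

lemma mult_unit_matrix_mult_nth: "(A ** unit_matrix b j ** B) $ a $ c = A $ a $ b * B $ j $ c"
proof -
  have "(A ** unit_matrix b j ** B) $ a $ c = (\<Sum>k\<in>UNIV. (A ** unit_matrix b j) $ a $ k * B $ k $ c)"
    by (simp add: matrix_matrix_mult_def)
  also have "\<dots> = (\<Sum>k\<in>UNIV. if k = j then A $ a $ b * B $ j $ c else 0)"
    unfolding mult_unit_matrix_nth by (intro sum.cong) auto
  finally show ?thesis by simp
qed

lemma trace_unit_matrix_mult: "trace (unit_matrix b j ** B) = B $ j $ b"
proof -
  have "trace (unit_matrix b j ** B) = trace (B ** unit_matrix b j)" by (rule trace_mult_commute)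
  also have "\<dots> = B $ j $ b" by (simp add: trace_def mult_unit_matrix_nth)
  finally show ?thesis .
qed

context assoc_scheme
begin

lemma cpi_central: "P \<in> cpi S \<Longrightarrow> central S P"
  and cpi_idem: "P \<in> cpi S \<Longrightarrow> P ** P = P"
  and cpi_nonzero: "P \<in> cpi S \<Longrightarrow> P \<noteq> 0"
  and cpi_minimal: "P \<in> cpi S \<Longrightarrow> central S F \<Longrightarrow> F ** F = F \<Longrightarrow> F ** P = F \<Longrightarrow> F = 0 \<or> F = P"
  unfolding cpi_def central_idem_iff by blast+

lemma central_range_submodule:
  assumes "central S E"
  shows "submodule S (range ((*v) E))"
  unfolding submodule_def
proof (intro conjI ballI)
  show "vec.subspace (range ((*v) E))" by (rule subspace_range_mult_vec)
  fix A w assume A: "A \<in> adj_alg S" and "w \<in> range ((*v) E)"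
  then obtain v where "w = E *v v" by auto
  then have "A *v w = E *v (A *v v)"
    using central_commute[OF assms A] by (simp add: matrix_vector_mul_assoc)
  then show "A *v w \<in> range ((*v) E)" by blast
qed

text \<open>The centre has no nilpotents, so multiplication by a central \<open>K\<close> is bijective on the ideal
  generated by \<open>K\<close>, and the preimage of \<open>K\<close> is an identity element of that ideal.\<close>

lemma ex_central_idem_ideal:
  assumes K: "central S K"
  shows "\<exists>F X. central S X \<and> F = K ** X \<and> F ** F = F \<and> K ** F = K"
proof -
  define J where "J = (\<lambda>X. K ** X) ` {X. central S X}"
  \<comment> \<open>Multiplication by \<open>K\<close> is taken as a real linear map, so that
    \<open>subspace\<close> and \<open>dim\<close> of the Euclidean space of matrices apply.\<close>
  have lin: "linear (\<lambda>X::complex^'n^'n. K ** X)"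
    by (rule linearI) (simp_all add: matrix_mult_add_right scaleR_eq_cscale)
  have "subspace {X. central S X}"
    by (auto simp: subspace_def central_add scaleR_eq_cscale central_cscale)
  then have sub: "subspace J" unfolding J_def using lin linear_subspace_image by blast
  have inj: "inj_on (\<lambda>X. K ** X) (span J)"
  proof (subst linear_injective_on_subspace_0[OF lin subspace_span], intro ballI impI)
    fix Y assume Y: "Y \<in> span J" and Y0: "K ** Y = 0"
    have "span J = J" using sub by simp
    then obtain X where X: "central S X" "Y = K ** X"
      using Y unfolding J_def by blast
    have "X ** Y = Y ** X"
      using X central_commute central_mult[OF K X(1)] central_mem by metis
    then have "Y ** Y = K ** Y ** X"
      using X(2) by (metis matrix_mul_assoc)
    then have "Y ** Y = 0" using Y0 by simp
    moreover have "central S Y" using X K central_mult by blast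
    ultimately show "Y = 0" using central_square_0 by blast
  qed
  have "(\<lambda>X. K ** X) ` J = J"
  proof (rule subspace_dim_equal)
    show "subspace ((\<lambda>X. K ** X) ` J)" using lin sub linear_subspace_image by blast
    show "(\<lambda>X. K ** X) ` J \<subseteq> J" using K central_mult unfolding J_def by auto
    show "dim J \<le> dim ((\<lambda>X. K ** X) ` J)" using dim_image_eq[OF lin inj] by simp
  qed (rule sub)
  moreover have "K \<in> J" unfolding J_def using central_mat_1 by (auto intro!: image_eqI[of _ _ "mat 1"])
  ultimately obtain F where F: "F \<in> J" "K = K ** F" by blast
  then obtain X where X: "central S X" "F = K ** X" by (auto simp: J_def)
  have "F ** K = K"
    using F(2) X K central_commute central_mult central_mem by metis
  then have "F ** F = F" using X(2) by (metis matrix_mul_assoc)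
  then show ?thesis using X F by metis
qed

text \<open>Let \<open>u\<close> in the range of \<open>P\<close> be an eigenvector for the value
  \<open>c\<close>. The idempotent \<open>F\<close> generating the ideal of \<open>K\<close> lies
  below \<open>P\<close> and kills \<open>u\<close>, so minimality of \<open>P\<close> forces
  \<open>F = 0\<close> and hence \<open>K = 0\<close>.\<close>

lemma central_mult_cpi_scalar:
  assumes P: "P \<in> cpi S" and Z: "central S Z"
  shows "\<exists>c. Z ** P = cscale c P"
proof -
  let ?U = "range ((*v) P)"
  have cP: "central S P" and idP: "P ** P = P" using P by (simp_all add: cpi_central cpi_idem)
  have ZP: "central S (Z ** P)" using Z cP by (rule central_mult)
  have "(Z ** P) *v u \<in> ?U" if "u \<in> ?U" for u
    using that central_range_submodule[OF cP] central_mem[OF ZP] unfolding submodule_def by blast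
  moreover obtain v where "P *v v \<noteq> 0"
    using cpi_nonzero[OF P] matrix_eqI_vec[of P 0] by auto
  ultimately obtain c u where u: "u \<in> ?U" "u \<noteq> 0" "(Z ** P) *v u = c *s u"
    using ex_eigenvector_in_subspace[OF subspace_range_mult_vec[of P], of "Z ** P" "P *v v"] by blast
  have Pu: "P *v u = u" using u(1) idempotent_vec[OF idP] by auto
  define K where "K = Z ** P - cscale c P"
  have K: "central S K" unfolding K_def using ZP cP central_diff central_cscale by blast
  have Ku: "K *v u = 0"
    by (simp add: K_def matrix_vector_mult_diff_rdistrib cscale_mult_vec u(3) Pu)
  have KP: "K ** P = K"
    by (simp add: K_def matrix_mult_diff_left idP flip: matrix_mul_assoc)
  obtain F X where F: "central S X" "F = K ** X" "F ** F = F" "K ** F = K"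
    using ex_central_idem_ideal[OF K] by blast
  have FX: "F = X ** K" using F(1,2) K central_commute central_mem by metis
  then have "F ** P = F" using KP by (metis matrix_mul_assoc)
  moreover have "central S F" using F K central_mult by blast
  moreover have "F *v u = 0"
    unfolding FX by (simp add: Ku flip: matrix_vector_mul_assoc)
  ultimately have "F = 0" using cpi_minimal[OF P] F(3) Pu u(2) by metis
  then have "K = 0" using F(4) by simp
  then have "Z ** P = cscale c P" by (simp add: K_def)
  then show ?thesis by blast
qed

text \<open>A central idempotent that is neither 0 nor primitive splits into two of smaller rank.
  Applied to \<open>mat 1\<close>, the rule replaces the decomposition of the identity into
  primitive idempotents.\<close>

lemma central_idem_induct [consumes 1, case_names zero cpi add]:
  assumes E: "central_idem S E"
    and zero: "Q 0"
    and cpi: "\<And>P. P \<in> cpi S \<Longrightarrow> Q P"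
    and add: "\<And>E F. central_idem S E \<Longrightarrow> central_idem S F \<Longrightarrow> Q E \<Longrightarrow> Q F \<Longrightarrow> Q (E + F)"
  shows "Q E"
  using E
proof (induction "rank E" arbitrary: E rule: less_induct)
  case less
  have cE: "central S E" and idE: "E ** E = E" using less.prems by (auto simp: central_idem_iff)
  show ?case
  proof (cases "E = 0 \<or> E \<in> cpi S")
    case True
    then show ?thesis using zero cpi by blast
  next
    case False
    then obtain F where F: "central_idem S F" "F ** E = F" "F \<noteq> 0" "F \<noteq> E"
      unfolding cpi_def using less.prems by blast
    have cF: "central S F" and idF: "F ** F = F" using F by (auto simp: central_idem_iff)
    have EF: "E ** F = F" using F(2) central_commute[OF cE central_mem[OF cF]] by simp
    have idG: "(E - F) ** (E - F) = E - F" using idempotent_diff[OF idE idF F(2) EF] .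
    then have G: "central_idem S (E - F)" using central_diff[OF cE cF] by (simp add: central_idem_iff)
    have "complex_of_nat (rank E) = of_nat (rank F) + of_nat (rank (E - F))"
      unfolding rank_idempotent[OF idE] rank_idempotent[OF idF] rank_idempotent[OF idG] trace_diff
      by simp
    then have "rank E = rank F + rank (E - F)" by (metis of_nat_add of_nat_eq_iff)
    moreover have "rank F > 0" "rank (E - F) > 0"
      using rank_idempotent_pos[OF idF] rank_idempotent_pos[OF idG] F by auto
    ultimately have "Q F" "Q (E - F)" using less.hyps F(1) G by auto
    then have "Q (F + (E - F))" using add F(1) G by blast
    then show ?thesis by simp
  qed
qed

lemma eq_0_if_cpi_mult_eq_0:
  fixes D :: "complex^'n^'n"
  assumes "\<And>P. P \<in> cpi S \<Longrightarrow> D ** P = 0"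
  shows "D = 0"
proof -
  have "central_idem S (mat 1)" using central_mat_1 by (simp add: central_idem_iff)
  then have "D ** mat 1 = 0"
    by (induction rule: central_idem_induct) (simp_all add: assms matrix_mult_add_right)
  then show ?thesis by simp
qed

text \<open>A nonzero submodule of least dimension inside the range of \<open>P\<close> works. This
  makes the choice in \<open>nP\<close> meaningful.\<close>

lemma ex_irred_submodule:
  assumes P: "P \<in> cpi S"
  shows "\<exists>W. irred_submodule S W \<and> (\<forall>w\<in>W. P *v w = w)"
proof -
  define sm where "sm W \<longleftrightarrow> submodule S W \<and> W \<noteq> {0} \<and> W \<subseteq> range ((*v) P)" for W
  have "\<exists>v. P *v v \<noteq> 0" using cpi_nonzero[OF P] matrix_eqI_vec[of P 0] by auto
  then have "sm (range ((*v) P))"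
    using central_range_submodule[OF cpi_central[OF P]] unfolding sm_def by auto
  then obtain W where W: "sm W" and min: "\<And>U. sm U \<Longrightarrow> vec.dim W \<le> vec.dim U"
    using ex_has_least_nat[of sm _ vec.dim] by blast
  have "U = {0} \<or> U = W" if U: "submodule S U" "U \<subseteq> W" for U
  proof (cases "U = {0}")
    case False
    then have "sm U" using U W unfolding sm_def by blast
    then have "vec.dim W \<le> vec.dim U" by (rule min)
    then show ?thesis
      using vec.subspace_dim_equal[of U W] U W unfolding sm_def submodule_def by blast
  qed simp
  then have "irred_submodule S W" using W unfolding irred_submodule_def sm_def by blast
  moreover have "P *v w = w" if "w \<in> W" for w
    using that W idempotent_vec[OF cpi_idem[OF P]] unfolding sm_def by auto
  ultimately show ?thesis by blast
qed

lemma nP_irred_submodule: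
  assumes P: "P \<in> cpi S"
  shows "\<exists>W. irred_submodule S W \<and> (\<forall>w\<in>W. P *v w = w) \<and> nP S P = vec.dim W"
proof -
  have "\<exists>d W. irred_submodule S W \<and> (\<forall>w\<in>W. P *v w = w) \<and> d = vec.dim W"
    using ex_irred_submodule[OF P] by blast
  from someI_ex[OF this] show ?thesis unfolding nP_def .
qed

section \<open>Schur's lemma and the Casimir eigenvalues\<close>

text \<open>An eigenspace of \<open>K\<close> in \<open>W\<close> is a nonzero submodule, hence all
  of \<open>W\<close>. Commutation is asked on \<open>W\<close> only, because the operator it is
  applied to contains a projection that may fail to commute with the algebra elsewhere.\<close>

lemma schur:
  assumes W: "irred_submodule S W"
    and K: "\<And>w. w \<in> W \<Longrightarrow> K *v w \<in> W"
    and comm: "\<And>X w. X \<in> adj_alg S \<Longrightarrow> w \<in> W \<Longrightarrow> K *v (X *v w) = X *v (K *v w)"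
  shows "\<exists>c. \<forall>w\<in>W. K *v w = c *s w"
proof -
  have sub: "vec.subspace W" and inv: "\<And>X w. X \<in> adj_alg S \<Longrightarrow> w \<in> W \<Longrightarrow> X *v w \<in> W"
    and ne: "W \<noteq> {0}" and irr: "\<And>U. submodule S U \<Longrightarrow> U \<subseteq> W \<Longrightarrow> U = {0} \<or> U = W"
    using W unfolding irred_submodule_def submodule_def by auto
  obtain v where "v \<in> W" "v \<noteq> 0" using ne vec.subspace_0[OF sub] by blast
  then obtain c u where u: "u \<in> W" "u \<noteq> 0" "K *v u = c *s u"
    using ex_eigenvector_in_subspace[OF sub K] by blast
  define U where "U = {w \<in> W. K *v w = c *s w}"
  have "submodule S U"
    unfolding submodule_def
  proof (intro conjI ballI)
    show "vec.subspace U"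
      using sub unfolding vec.subspace_def U_def
      by (auto simp: matrix_vector_right_distrib vec.scale_right_distrib vec.scale mult.commute)
    fix A w assume "A \<in> adj_alg S" "w \<in> U"
    then show "A *v w \<in> U" unfolding U_def by (simp add: inv comm vec.scale)
  qed
  moreover have "U \<subseteq> W" "U \<noteq> {0}" using u unfolding U_def by auto
  ultimately have "U = W" using irr by blast
  then show ?thesis unfolding U_def by blast
qed

text \<open>Let \<open>H\<close> project onto an irreducible module \<open>W\<close>. The element
  \<open>e\<close> representing its character under the trace form is a multiple \<open>m\<close> of
  \<open>P\<close>, and evaluation at \<open>P\<close> gives \<open>m\<close>. Averaging and Schur's
  lemma show that \<open>e\<close> also acts on \<open>W\<close> as \<open>l / nP S P\<close>, where
  \<open>l\<close> is the Casimir eigenvalue at \<open>P\<close>; comparison yields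
  \<open>l\<close>.\<close>

lemma
  assumes P: "P \<in> cpi S"
  shows nP_pos: "nP S P > 0"
    and casimir_mult_cpi:
      "casimir S (mat 1) ** P = cscale (of_nat (nP S P) ^ 2 / of_nat (rank P)) P"
    and ex_irred_projection: "\<exists>H. H ** H = H \<and> trace H = of_nat (nP S P) \<and>
      (\<forall>X\<in>adj_alg S. H ** X ** H = X ** H) \<and>
      (\<forall>X\<in>adj_alg S. trace (X ** H) = of_nat (nP S P) / of_nat (rank P) * trace (P ** X))"
proof -
  obtain W where W: "irred_submodule S W" "\<And>w. w \<in> W \<Longrightarrow> P *v w = w" "nP S P = vec.dim W"
    using nP_irred_submodule[OF P] by blast
  have sub: "vec.subspace W" and inv: "\<And>X w. X \<in> adj_alg S \<Longrightarrow> w \<in> W \<Longrightarrow> X *v w \<in> W"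
    and ne: "W \<noteq> {0}"
    using W(1) unfolding irred_submodule_def submodule_def by auto
  obtain H where idH: "H ** H = H" and rH: "range ((*v) H) = W" using ex_projection[OF sub] by blast
  have Hw: "H *v w = w" if "w \<in> W" for w using that idempotent_vec[OF idH] rH by (metis imageE)
  have HW: "H *v v \<in> W" for v using rH by blast
  have trH: "trace H = of_nat (nP S P)" using trace_idempotent[OF idH] W(3) rH by simp
  show d_pos: "nP S P > 0"
  proof (rule ccontr)
    assume "\<not> nP S P > 0"
    then have "W \<subseteq> {0}" using W(3) by simp
    then show False using ne vec.subspace_0[OF sub] by blast
  qed
  then have "H \<noteq> 0" using trH by (auto simp: trace_def)
  have PH: "P ** H = H"
    by (rule matrix_eqI_vec) (simp add: W(2) HW flip: matrix_vector_mul_assoc)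
  have HXH: "H ** X ** H = X ** H" if "X \<in> adj_alg S" for X
    by (rule matrix_eqI_vec) (simp add: Hw HW inv[OF that] flip: matrix_vector_mul_assoc)
  have cP: "central S P" and idP: "P ** P = P" using P by (simp_all add: cpi_central cpi_idem)
  have rP: "rank P > 0" using rank_idempotent_pos[OF idP cpi_nonzero[OF P]] .

  \<comment> \<open>The coefficients are the character values on the dual basis, which is what makes
    \<open>tr_e\<close> hold.\<close>
  define e where "e = (\<Sum>s\<in>S. cscale (trace (adj (s\<inverse>) ** H) / of_nat (card s)) (adj s))"
  have e_mem: "e \<in> adj_alg S"
    unfolding e_def by (intro adj_alg_sum adj_alg_cscale adj_mem)
  have tr_e: "trace (e ** X) = trace (X ** H)" if X: "X \<in> adj_alg S" for X
  proof -
    have "trace (X ** H) =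
      trace ((\<Sum>t\<in>S. cscale (trace (X ** adj t) / of_nat (card t)) (adj (t\<inverse>))) ** H)"
      using adj_alg_expansion_converse[OF X] by metis
    also have "\<dots> = (\<Sum>t\<in>S. trace (X ** adj t) / of_nat (card t) * trace (adj (t\<inverse>) ** H))"
      by (simp add: matrix_mult_sum_left trace_sum trace_cscale)
    also have "\<dots> = trace (e ** X)"
      by (simp add: e_def matrix_mult_sum_left trace_sum trace_cscale trace_mult_commute[of X] mult.commute)
    finally show ?thesis by simp
  qed
  \<comment> \<open>The character is a class function: invariance of \<open>W\<close> allows a
    second \<open>H\<close> to be inserted, and then cyclicity applies.\<close>
  have tr_H_comm: "trace (X ** Y ** H) = trace (Y ** X ** H)" if "X \<in> adj_alg S" "Y \<in> adj_alg S" for X Y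
  proof -
    have "trace (X ** Y ** H) = trace (X ** (H ** Y ** H))"
      using HXH[OF that(2)] by (simp add: matrix_mul_assoc)
    also have "\<dots> = trace ((Y ** H) ** (X ** H))"
      using trace_mult_commute[of "X ** H" "Y ** H"] by (simp add: matrix_mul_assoc)
    also have "\<dots> = trace (Y ** (H ** X ** H))" by (simp add: matrix_mul_assoc)
    also have "\<dots> = trace (Y ** X ** H)"
      using HXH[OF that(1)] by (simp add: matrix_mul_assoc)
    finally show ?thesis .
  qed
  have e_central: "central S e"
  proof (rule centralI[OF e_mem], rule adj_alg_eqI)
    fix Y X assume Y: "Y \<in> adj_alg S" and X: "X \<in> adj_alg S"
    show "e ** Y \<in> adj_alg S" "Y ** e \<in> adj_alg S" using e_mem Y by (auto intro: adj_alg_mult)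
    have "trace (Y ** e ** X) = trace (e ** (X ** Y))"
      using trace_mult_commute[of Y "e ** X"] by (simp add: matrix_mul_assoc)
    also have "\<dots> = trace (e ** (Y ** X))"
      using tr_e[OF adj_alg_mult[OF X Y]] tr_e[OF adj_alg_mult[OF Y X]] tr_H_comm[OF X Y] by simp
    finally show "trace (e ** Y ** X) = trace (Y ** e ** X)" by (simp add: matrix_mul_assoc)
  qed
  have eP: "e ** P = e"
  proof (rule adj_alg_eqI[OF _ e_mem])
    show "e ** P \<in> adj_alg S" using e_mem central_mem[OF cP] by (rule adj_alg_mult)
    fix X assume X: "X \<in> adj_alg S"
    have "P ** X ** H = X ** H"
      using central_commute[OF cP X] PH by (metis matrix_mul_assoc)
    then show "trace (e ** P ** X) = trace (e ** X)"
      using tr_e[OF X] tr_e[OF adj_alg_mult[OF central_mem[OF cP] X]] by (simp add: matrix_mul_assoc)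
  qed
  obtain m where m: "e = cscale m P" using central_mult_cpi_scalar[OF P e_central] eP by auto
  have trHX: "trace (X ** H) = m * trace (P ** X)" if "X \<in> adj_alg S" for X
    using tr_e[OF that] by (simp add: m trace_cscale)
  have "of_nat (nP S P) = m * of_nat (rank P)"
    using trHX[OF central_mem[OF cP]] unfolding PH idP trH rank_idempotent[OF idP] .
  then have m_eq: "m = of_nat (nP S P) / of_nat (rank P)" using rP by (simp add: field_simps)
  show "\<exists>H. H ** H = H \<and> trace H = of_nat (nP S P) \<and>
      (\<forall>X\<in>adj_alg S. H ** X ** H = X ** H) \<and>
      (\<forall>X\<in>adj_alg S. trace (X ** H) = of_nat (nP S P) / of_nat (rank P) * trace (P ** X))"
    using idH trH HXH trHX m_eq by blast

  obtain l where l: "casimir S (mat 1) ** P = cscale l P"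
    using central_mult_cpi_scalar[OF P casimir_central] by blast
  have lH: "casimir S (mat 1) ** H = cscale l H"
    using l PH by (metis matrix_mul_assoc cscale_mult_left)
  \<comment> \<open>Schur orthogonality: the averaged operator is a scalar on \<open>W\<close>, and
    taking traces determines it.\<close>
  have K: "casimir S (H ** unit_matrix b j) ** H = cscale (l / of_nat (nP S P) * H $ j $ b) H" for b j
  proof -
    define K where "K = casimir S (H ** unit_matrix b j) ** H"
    have KW: "K *v w \<in> W" for w
    proof -
      have "H ** K = K"
      proof -
        have "H ** (adj s ** (H ** unit_matrix b j) ** adj (s\<inverse>)) = adj s ** (H ** unit_matrix b j) ** adj (s\<inverse>)"
          if "s \<in> S" for s
          using HXH[OF adj_mem[OF that]] by (simp add: matrix_mul_assoc)
        then have "H ** casimir S (H ** unit_matrix b j) = casimir S (H ** unit_matrix b j)"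
          unfolding casimir_def matrix_mult_sum_right cscale_mult_right by (intro sum.cong) simp_all
        then show ?thesis unfolding K_def by (simp add: matrix_mul_assoc)
      qed
      then have "K *v w = H *v (K *v w)" by (simp add: matrix_vector_mul_assoc)
      then show ?thesis using HW by metis
    qed
    have "\<exists>c. \<forall>w\<in>W. K *v w = c *s w"
    proof (rule schur[OF W(1)])
      fix X w assume X: "X \<in> adj_alg S" and w: "w \<in> W"
      have "K *v (X *v w) = casimir S (H ** unit_matrix b j) *v (X *v w)"
        unfolding K_def by (simp add: Hw inv[OF X w] flip: matrix_vector_mul_assoc)
      also have "\<dots> = X *v (casimir S (H ** unit_matrix b j) *v w)"
        using casimir_commute[OF X] by (simp add: matrix_vector_mul_assoc)
      also have "\<dots> = X *v (K *v w)"
        unfolding K_def by (simp add: Hw[OF w] flip: matrix_vector_mul_assoc)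
      finally show "K *v (X *v w) = X *v (K *v w)" .
    qed (rule KW)
    then obtain c where c: "\<And>w. w \<in> W \<Longrightarrow> K *v w = c *s w" by blast
    have KH: "K = cscale c H"
    proof (rule matrix_eqI_vec)
      fix v
      have "K *v v = K *v (H *v v)"
        unfolding K_def by (simp add: matrix_vector_mul_assoc idH flip: matrix_mul_assoc)
      then show "K *v v = cscale c H *v v" using c[OF HW] by (simp add: cscale_mult_vec)
    qed
    have "trace K = (\<Sum>s\<in>S. 1 / of_nat (card s) *
        trace (adj s ** H ** unit_matrix b j ** adj (s\<inverse>) ** H))"
      by (simp add: K_def casimir_def matrix_mult_sum_left trace_sum trace_cscale matrix_mul_assoc)
    also have "\<dots> = (\<Sum>s\<in>S. 1 / of_nat (card s) * trace (unit_matrix b j ** (adj (s\<inverse>) ** adj s ** H)))"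
    proof (intro sum.cong refl arg_cong2[of _ _ _ _ "(*)"])
      fix s assume s: "s \<in> S"
      have "trace (adj s ** H ** unit_matrix b j ** adj (s\<inverse>) ** H) =
          trace ((adj s ** H) ** (unit_matrix b j ** adj (s\<inverse>) ** H))"
        by (simp add: matrix_mul_assoc)
      also have "\<dots> = trace (unit_matrix b j ** adj (s\<inverse>) ** (H ** adj s ** H))"
        unfolding trace_mult_commute[of "adj s ** H"] by (simp add: matrix_mul_assoc)
      finally show "trace (adj s ** H ** unit_matrix b j ** adj (s\<inverse>) ** H) =
          trace (unit_matrix b j ** (adj (s\<inverse>) ** adj s ** H))"
        unfolding HXH[OF adj_mem[OF s]] by (simp add: matrix_mul_assoc)
    qed
    also have "\<dots> = trace (unit_matrix b j ** ((\<Sum>s\<in>S. cscale (1 / of_nat (card s)) (adj (s\<inverse>) ** adj s)) ** H))"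
      by (simp add: matrix_mult_sum_left matrix_mult_sum_right trace_sum trace_cscale)
    \<comment> \<open>Both orders of the factors give the same sum, since \<open>S\<close> is closed
      under converse and converse relations have equal size.\<close>
    also have "(\<Sum>s\<in>S. cscale (1 / of_nat (card s)) (adj (s\<inverse>) ** adj s)) = casimir S (mat 1)"
      unfolding casimir_def
      by (subst sum_converse[symmetric]) simp
    finally have "c * of_nat (nP S P) = l * H $ j $ b"
      unfolding KH lH by (simp add: trace_cscale trH trace_unit_matrix_mult)
    then have "c = l / of_nat (nP S P) * H $ j $ b" using d_pos by (simp add: field_simps)
    then show ?thesis using KH unfolding K_def by simp
  qed
  have "(e ** H) $ a $ b = l / of_nat (nP S P) * H $ a $ b" for a b
  proof -
    have "(e ** H) $ a $ b =
        (\<Sum>s\<in>S. trace (adj (s\<inverse>) ** H) / of_nat (card s) * (adj s ** H) $ a $ b)"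
      by (simp add: e_def matrix_mult_sum_left)
    \<comment> \<open>Writing the trace as a sum over \<open>j\<close> leaves products of two
      entries; inserting \<open>unit_matrix b j\<close> makes each a single entry of a matrix
      product.\<close>
    also have "\<dots> = (\<Sum>j\<in>UNIV. \<Sum>s\<in>S. 1 / of_nat (card s) * ((adj s ** H) $ a $ b * (adj (s\<inverse>) ** H) $ j $ j))"
      by (subst sum.swap) (simp add: trace_def sum_distrib_left sum_divide_distrib mult_ac)
    also have "\<dots> = (\<Sum>j\<in>UNIV. (casimir S (H ** unit_matrix b j) ** H) $ a $ j)"
    proof (rule sum.cong[OF refl])
      fix j
      have "(casimir S (H ** unit_matrix b j) ** H) $ a $ j = (\<Sum>s\<in>S. 1 / of_nat (card s) *
          ((adj s ** H) ** unit_matrix b j ** (adj (s\<inverse>) ** H)) $ a $ j)"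
        by (simp add: casimir_def matrix_mult_sum_left matrix_mul_assoc)
      then show "(\<Sum>s\<in>S. 1 / of_nat (card s) * ((adj s ** H) $ a $ b * (adj (s\<inverse>) ** H) $ j $ j)) =
          (casimir S (H ** unit_matrix b j) ** H) $ a $ j"
        unfolding mult_unit_matrix_mult_nth by simp
    qed
    also have "\<dots> = l / of_nat (nP S P) * (\<Sum>j\<in>UNIV. H $ a $ j * H $ j $ b)"
      unfolding K by (simp add: sum_distrib_left mult_ac)
    also have "(\<Sum>j\<in>UNIV. H $ a $ j * H $ j $ b) = (H ** H) $ a $ b"
      by (simp add: matrix_matrix_mult_def)
    finally show ?thesis unfolding idH .
  qed
  then have "e ** H = cscale (l / of_nat (nP S P)) H" by (simp add: vec_eq_iff)
  then have "m = l / of_nat (nP S P)"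
    using \<open>H \<noteq> 0\<close> unfolding m by (simp add: PH cscale_eq_iff)
  then have "l = of_nat (nP S P) ^ 2 / of_nat (rank P)"
    using m_eq d_pos by (simp add: field_simps power2_eq_square)
  then show "casimir S (mat 1) ** P = cscale (of_nat (nP S P) ^ 2 / of_nat (rank P)) P"
    using l by simp
qed

end

section \<open>Integrality of traces\<close>

inductive_set int_span :: "complex set \<Rightarrow> complex set" for B where
  zero: "0 \<in> int_span B"
| add: "x \<in> int_span B \<Longrightarrow> b \<in> B \<Longrightarrow> x + of_int k * b \<in> int_span B"

lemma int_span_base: "b \<in> B \<Longrightarrow> b \<in> int_span B"
  using int_span.add[OF int_span.zero, of b B 1] by simp

lemma int_span_add: "x \<in> int_span B \<Longrightarrow> y \<in> int_span B \<Longrightarrow> x + y \<in> int_span B"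
proof (induction x rule: int_span.induct)
  case (add x b k)
  then show ?case using int_span.add[of "x + y" B b k] by (simp add: add_ac)
qed simp

lemma int_span_of_int_mult: "x \<in> int_span B \<Longrightarrow> of_int n * x \<in> int_span B"
proof (induction x rule: int_span.induct)
  case (add x b k)
  then show ?case using int_span.add[of "of_int n * x" B b "n * k"] by (simp add: algebra_simps)
qed (simp add: int_span.zero)

lemma int_span_sum: "(\<And>i. i \<in> I \<Longrightarrow> f i \<in> int_span B) \<Longrightarrow> (\<Sum>i\<in>I. f i) \<in> int_span B"
  by (induction I rule: infinite_finite_induct) (simp_all add: int_span.zero int_span_add)

lemma int_span_mult:
  assumes "x \<in> int_span B" "\<And>b. b \<in> B \<Longrightarrow> c * b \<in> int_span C"
  shows "c * x \<in> int_span C"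
  using assms(1)
proof (induction x rule: int_span.induct)
  case (add x b k)
  have "c * (x + of_int k * b) = c * x + of_int k * (c * b)" by (simp add: algebra_simps)
  then show ?case using add assms(2) by (simp add: int_span_add int_span_of_int_mult)
qed (simp add: int_span.zero)

text \<open>Integrality via a finitely generated nonzero \<open>z\<close>-stable \<open>\<int>\<close>-submodule of \<open>\<complex>\<close>; this form makes
  eigenvalues of integer matrices and sums of integral numbers integral without any determinants.\<close>

definition integral_num :: "complex \<Rightarrow> bool" where
  "integral_num z \<longleftrightarrow> (\<exists>B. finite B \<and> (\<exists>b\<in>B. b \<noteq> 0) \<and> (\<forall>b\<in>B. z * b \<in> int_span B))"

lemma integral_num_0 [simp]: "integral_num 0"
  unfolding integral_num_def by (rule exI[of _ "{1}"]) (simp add: int_span.zero)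

text \<open>The products of the generators for \<open>x\<close> with those for \<open>y\<close> span
  a group stable under both numbers.\<close>

lemma integral_num_add:
  assumes "integral_num x" "integral_num y"
  shows "integral_num (x + y)"
proof -
  obtain B where B: "finite B" "\<exists>b\<in>B. b \<noteq> 0" "\<And>b. b \<in> B \<Longrightarrow> x * b \<in> int_span B"
    using assms(1) unfolding integral_num_def by blast
  obtain C where C: "finite C" "\<exists>c\<in>C. c \<noteq> 0" "\<And>c. c \<in> C \<Longrightarrow> y * c \<in> int_span C"
    using assms(2) unfolding integral_num_def by blast
  define D where "D = (\<lambda>(b, c). b * c) ` (B \<times> C)"
  have mem: "b * c \<in> D" if "b \<in> B" "c \<in> C" for b c using that unfolding D_def by force
  have "(x + y) * d \<in> int_span D" if d: "d \<in> D" for d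
  proof -
    obtain b c where bc: "b \<in> B" "c \<in> C" "d = b * c" using d unfolding D_def by auto
    have "c * (x * b) \<in> int_span D"
      using int_span_mult[OF B(3)[OF bc(1)], of c D] mem bc(2) by (simp add: int_span_base mult.commute)
    moreover have "b * (y * c) \<in> int_span D"
      using int_span_mult[OF C(3)[OF bc(2)], of b D] mem bc(1) by (simp add: int_span_base)
    moreover have "(x + y) * d = c * (x * b) + b * (y * c)" by (simp add: bc(3) algebra_simps)
    ultimately show ?thesis by (simp add: int_span_add)
  qed
  moreover have "finite D" using B(1) C(1) unfolding D_def by simp
  moreover have "\<exists>d\<in>D. d \<noteq> 0" using B(2) C(2) mem by (metis mult_eq_0_iff)
  ultimately show ?thesis unfolding integral_num_def by blast
qed

text \<open>The entries of the eigenvector serve as the generators.\<close>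

lemma integral_num_eigenvalue:
  fixes A :: "complex^'n^'n"
  assumes "\<And>i j. A $ i $ j \<in> \<int>" "A *v v = z *s v" "v \<noteq> 0"
  shows "integral_num z"
  unfolding integral_num_def
proof (intro exI conjI ballI)
  let ?B = "range (\<lambda>i. v $ i)"
  show "finite ?B" by simp
  show "\<exists>b\<in>?B. b \<noteq> 0" using assms(3) by (auto simp: vec_eq_iff)
  fix b assume "b \<in> ?B"
  then obtain i where i: "b = v $ i" by blast
  have "z * b = (A *v v) $ i" by (simp add: assms(2) i)
  also have "\<dots> = (\<Sum>j\<in>UNIV. A $ i $ j * v $ j)" by (simp add: matrix_vector_mult_def)
  also have "\<dots> \<in> int_span ?B"
  proof (rule int_span_sum)
    fix j
    obtain k where "A $ i $ j = of_int k" using assms(1) Ints_cases by blast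
    then show "A $ i $ j * v $ j \<in> int_span ?B"
      by (simp add: int_span_of_int_mult int_span_base)
  qed
  finally show "z * b \<in> int_span ?B" .
qed

section \<open>Rational integral numbers are integers\<close>

interpretation complex_over_rat: vector_space "\<lambda>r (z::complex). of_rat r * z"
  by unfold_locales (simp_all add: algebra_simps of_rat_add of_rat_mult)

interpretation rat_over_rat: vector_space "\<lambda>r (z::rat). r * z"
  by unfold_locales (simp_all add: algebra_simps)

interpretation complex_rat_pair: vector_space_pair "\<lambda>r (z::complex). of_rat r * z" "\<lambda>r (z::rat). r * z"
  by unfold_locales

text \<open>Since \<open>{1}\<close> is independent over the rationals, the value at 1 can be
  prescribed. The functional carries the integrality argument from complex to rational
  numbers.\<close>

lemma ex_rat_functional:
  "\<exists>\<phi> :: complex \<Rightarrow> rat. (\<forall>x y. \<phi> (x + y) = \<phi> x + \<phi> y) \<and> (\<forall>r x. \<phi> (of_rat r * x) = r * \<phi> x) \<and> \<phi> 1 = 1"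
proof -
  have "complex_over_rat.independent {1}"
    by (simp add: complex_over_rat.dependent_single)
  from complex_rat_pair.linear_independent_extend[OF this, of "\<lambda>_. 1"]
  obtain g where g: "Vector_Spaces.linear (\<lambda>r z. of_rat r * z) (\<lambda>r z. r * z) g" "g (1::complex) = (1::rat)"
    by auto
  interpret g: Vector_Spaces.linear "\<lambda>r (z::complex). of_rat r * z" "\<lambda>r (z::rat). r * z" g by (rule g(1))
  show ?thesis using g.add g.scale g(2) by blast
qed

text \<open>If q = a / b in lowest terms, every power of b divides \<open>D\<close>, which forces b
  = 1.\<close>

lemma rat_powers_bounded_denominator_imp_int:
  fixes q :: rat and D :: int
  assumes "D \<noteq> 0" "\<And>j. of_int D * q ^ j \<in> \<int>"
  shows "q \<in> \<int>"
proof -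
  obtain a b where ab: "quotient_of q = (a, b)" by (cases "quotient_of q")
  then have b: "b > 0" "coprime a b" and q: "q = of_int a / of_int b"
    using quotient_of_denom_pos quotient_of_coprime quotient_of_div by blast+
  have "b ^ j dvd D" for j
  proof -
    obtain k where "of_int D * q ^ j = of_int k" using assms(2) Ints_cases by blast
    then have "of_int D * of_int a ^ j = (of_int k * of_int b ^ j :: rat)"
      using b by (simp add: q field_simps power_divide)
    then have "of_int (D * a ^ j) = (of_int (k * b ^ j) :: rat)" by simp
    then have "D * a ^ j = k * b ^ j" by (rule of_int_eq_iff[THEN iffD1])
    then have "b ^ j dvd D * a ^ j" by simp
    then show ?thesis using b(2) by (simp add: coprime_dvd_mult_left_iff coprime_commute)
  qed
  then have le: "b ^ j \<le> \<bar>D\<bar>" for j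
    using assms(1) dvd_imp_le_int[of D "b ^ j"] b(1) by simp
  have "b = 1"
  proof (rule ccontr)
    assume "b \<noteq> 1"
    then have "b \<ge> 2" using b(1) by simp
    then have "2 ^ j \<le> b ^ j" for j by (intro power_mono) auto
    then have "2 ^ nat \<bar>D\<bar> \<le> \<bar>D\<bar>" using le order_trans by blast
    moreover have "int (nat \<bar>D\<bar>) < 2 ^ nat \<bar>D\<bar>" 
      by (metis less_exp of_nat_less_iff of_nat_numeral of_nat_power)
    ultimately show False by simp
  qed
  then show ?thesis using q by simp
qed

text \<open>After rescaling, the generators contain 1, so their span contains all powers of
  \<open>z\<close>. The rational functional maps these to the powers of \<open>q\<close>, and
  \<open>D\<close> clears the denominators of its values on all generators at once.\<close>

lemma rational_integral_num_imp_int: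
  assumes "integral_num z" "z \<in> \<rat>"
  shows "z \<in> \<int>"
proof -
  obtain q where q: "z = of_rat q" using assms(2) Rats_cases by blast
  obtain B b where B: "finite B" "b \<in> B" "b \<noteq> 0" "\<And>b. b \<in> B \<Longrightarrow> z * b \<in> int_span B"
    using assms(1) unfolding integral_num_def by blast
  define C where "C = (\<lambda>x. x / b) ` B"
  have stable: "z * x \<in> int_span C" if "x \<in> int_span C" for x
  proof (rule int_span_mult[OF that])
    fix c assume "c \<in> C"
    then obtain a where a: "a \<in> B" "c = a / b" unfolding C_def by blast
    have "(1 / b) * (z * a) \<in> int_span C"
      by (rule int_span_mult[OF B(4)[OF a(1)]]) (auto simp: C_def intro: int_span_base)
    then show "z * c \<in> int_span C" by (simp add: a(2))
  qed
  have "1 \<in> C" using B(2,3) unfolding C_def by force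
  then have pow: "z ^ j \<in> int_span C" for j
    by (induction j) (simp_all add: int_span_base stable)
  obtain \<phi> :: "complex \<Rightarrow> rat" where \<phi>: "\<And>x y. \<phi> (x + y) = \<phi> x + \<phi> y" "\<And>r x. \<phi> (of_rat r * x) = r * \<phi> x" "\<phi> 1 = 1"
    using ex_rat_functional by blast
  define D where "D = (\<Prod>c\<in>C. snd (quotient_of (\<phi> c)))"
  have "D \<noteq> 0" "finite C"
    using B(1) quotient_of_denom_pos' unfolding D_def C_def
    by (auto simp: prod_zero_iff) (metis less_irrefl)
  have D_base: "of_int D * \<phi> c \<in> \<int>" if c: "c \<in> C" for c
  proof -
    obtain n d where nd: "quotient_of (\<phi> c) = (n, d)" by (cases "quotient_of (\<phi> c)")
    then have "d dvd D" unfolding D_def using c \<open>finite C\<close> by (metis dvd_prodI snd_conv)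
    then obtain k where "D = d * k" by blast
    moreover have "\<phi> c = of_int n / of_int d" "d \<noteq> 0"
      using nd quotient_of_div quotient_of_denom_pos by fastforce+
    ultimately have "of_int D * \<phi> c = of_int (k * n)" by simp
    then show ?thesis by (metis Ints_of_int)
  qed
  have D_int: "of_int D * \<phi> x \<in> \<int>" if "x \<in> int_span C" for x
    using that
  proof (induction x rule: int_span.induct)
    case zero
    show ?case using \<phi>(2)[of 0 0] by simp
  next
    case (add x c k)
    have "of_int D * \<phi> (x + of_int k * c) = of_int D * \<phi> x + of_int k * (of_int D * \<phi> c)"
      using \<phi>(2)[of "of_int k" c] by (simp add: \<phi>(1) algebra_simps)
    then show ?case using add D_base by simp
  qed
  have "of_int D * q ^ j \<in> \<int>" for j
  proof -
    have "\<phi> (z ^ j) = q ^ j" using \<phi>(2)[of "q ^ j" 1] by (simp add: q \<phi>(3) of_rat_power)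
    then show ?thesis using D_int[OF pow, of j] by simp
  qed
  then have "q \<in> \<int>" using rat_powers_bounded_denominator_imp_int \<open>D \<noteq> 0\<close> by blast
  then obtain k where "q = of_int k" using Ints_cases by blast
  then show ?thesis by (simp add: q)
qed

text \<open>Deflation: subtracting \<open>v (row i M) / v\<^sub>i\<close> for an eigenvector \<open>v\<close> of \<open>M\<close> with value \<open>z\<close> and
  \<open>v\<^sub>i \<noteq> 0\<close> clears row \<open>i\<close>, lowers the trace by \<open>z\<close> and creates no new eigenvalue with an
  eigenvector supported away from \<open>i\<close>.\<close>

lemma trace_integral_if_eigenvalues_integral:
  fixes M :: "complex^'n^'n" and I :: "'n set"
  assumes "\<And>i j. i \<notin> I \<Longrightarrow> M $ i $ j = 0"
    and "\<And>z v. v \<noteq> 0 \<Longrightarrow> (\<And>i. i \<notin> I \<Longrightarrow> v $ i = 0) \<Longrightarrow> M *v v = z *s v \<Longrightarrow> integral_num z"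
  shows "integral_num (trace M)"
  using finite[of I] assms
proof (induction "card I" arbitrary: I M)
  case 0
  then have "M = 0" by (simp add: vec_eq_iff)
  then show ?case by (simp add: trace_def)
next
  case (Suc n)
  note rows = Suc.prems(2) and eig = Suc.prems(3)
  define U where "U = {v :: complex^'n. \<forall>i. i \<notin> I \<longrightarrow> v $ i = 0}"
  have "vec.subspace U" unfolding U_def vec.subspace_def by simp
  moreover have "M *v u \<in> U" for u
    unfolding U_def by (simp add: matrix_vector_mult_def rows)
  moreover obtain i0 where "i0 \<in> I" using Suc.hyps(2) by fastforce
  then have "axis i0 1 \<in> U" "axis i0 (1::complex) \<noteq> 0"
    unfolding U_def by (auto simp: axis_def vec_eq_iff)
  ultimately obtain z v where v: "v \<in> U" "v \<noteq> 0" "M *v v = z *s v"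
    using ex_eigenvector_in_subspace[of U M "axis i0 1"] by blast
  have z: "integral_num z" using eig[OF v(2) _ v(3)] v(1) unfolding U_def by blast
  obtain i where vi: "v $ i \<noteq> 0" using v(2) by (auto simp: vec_eq_iff)
  then have i: "i \<in> I" using v(1) unfolding U_def by blast
  define M' where "M' = (\<chi> j l. M $ j $ l - v $ j * M $ i $ l / v $ i)"
  have M'_vec: "M' *v x = M *v x - ((M *v x) $ i / v $ i) *s v" for x
    by (simp add: vec_eq_iff M'_def matrix_vector_mult_def algebra_simps sum_subtractf
        sum_distrib_left sum_distrib_right sum_divide_distrib)
  have "integral_num (trace M')"
  proof (rule Suc.hyps(1)[of "I - {i}"])
    show "n = card (I - {i})" using Suc.hyps(2) i by simp
    show "finite (I - {i})" by simp
    show "M' $ j $ l = 0" if "j \<notin> I - {i}" for j l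
      using that vi rows v(1) by (cases "j = i") (auto simp: M'_def U_def)
    fix y x assume x: "x \<noteq> 0" "\<And>j. j \<notin> I - {i} \<Longrightarrow> x $ j = 0" "M' *v x = y *s x"
    show "integral_num y"
    proof (cases "y = z")
      case False
      define c where "c = (M *v x) $ i / v $ i"
      \<comment> \<open>The multiple of \<open>v\<close> is chosen to absorb the term
        \<open>c *s v\<close> of \<open>M *v x\<close>, so \<open>w\<close> is an eigenvector of
        \<open>M\<close> for \<open>y\<close>. It is nonzero because \<open>x\<close> vanishes at
        \<open>i\<close> and \<open>v\<close> does not.\<close>
      define w where "w = x + (c / (y - z)) *s v"
      have Mx: "M *v x = y *s x + c *s v" using x(3) unfolding M'_vec c_def by (simp add: algebra_simps)
      have eq: "c + c / (y - z) * z = y * (c / (y - z))" using False by (simp add: field_simps)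
      have "M *v w = y *s x + (c + c / (y - z) * z) *s v"
        by (simp add: w_def matrix_vector_right_distrib vec.scale Mx v(3) vec.scale_left_distrib)
      then have "M *v w = y *s w" unfolding eq by (simp add: w_def vec.scale_right_distrib)
      moreover have "w \<noteq> 0"
      proof
        assume w0: "w = 0"
        have "x $ i = 0" using x(2) by simp
        then have c0: "c / (y - z) = 0"
          using arg_cong[OF w0, of "\<lambda>u. u $ i"] vi by (simp add: w_def)
        show False using w0 x(1) unfolding w_def c0 by simp
      qed
      moreover have "w $ j = 0" if "j \<notin> I" for j
        using that x(2) v(1) by (simp add: w_def U_def)
      ultimately show ?thesis using eig by blast
    qed (use z in simp)
  qed
  moreover have "trace M = trace M' + z"
  proof -
    have "trace M' = trace M - (\<Sum>j\<in>UNIV. v $ j * M $ i $ j / v $ i)"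
      by (simp add: trace_def M'_def sum_subtractf)
    also have "(\<Sum>j\<in>UNIV. v $ j * M $ i $ j / v $ i) = (M *v v) $ i / v $ i"
      by (simp add: matrix_vector_mult_def sum_divide_distrib mult.commute)
    also have "\<dots> = z" using vi by (simp add: v(3))
    finally show ?thesis by simp
  qed
  ultimately show ?case using z integral_num_add by simp
qed

text \<open>An eigenvector of \<open>A ** H\<close> with nonzero eigenvalue is fixed by
  \<open>H\<close>, hence is an eigenvector of the integer matrix \<open>A\<close>.\<close>

lemma integral_num_trace_invariant:
  fixes A H :: "complex^'n^'n"
  assumes A: "\<And>i j. A $ i $ j \<in> \<int>" and H: "H ** A ** H = A ** H"
  shows "integral_num (trace (A ** H))"
proof (rule trace_integral_if_eigenvalues_integral[of UNIV])
  fix z and v :: "complex^'n" assume v: "v \<noteq> 0" "A ** H *v v = z *s v"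
  show "integral_num z"
  proof (cases "z = 0")
    case False
    have "z *s (H *v v) = H *v ((A ** H) *v v)" by (simp only: v(2) vec.scale)
    also have "\<dots> = (H ** A ** H) *v v" by (simp only: matrix_vector_mul_assoc matrix_mul_assoc)
    also have "\<dots> = z *s v" by (simp only: H v(2))
    finally have "H *v v = v" using False by simp
    then have "A *v v = z *s v" using v(2) by (simp flip: matrix_vector_mul_assoc)
    then show ?thesis using integral_num_eigenvalue A v(1) by blast
  qed simp
qed simp

section \<open>Valencies and the Casimir element\<close>

lemma P0_nth [simp]: "(P0 :: complex^'n^'n) $ i $ j = 1 / of_nat CARD('n::finite)"
  by (simp add: P0_def)

lemma P0_idem: "P0 ** P0 = (P0 :: complex^'n::finite^'n)"
  by (simp add: vec_eq_iff matrix_matrix_mult_def)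

text \<open>Trace 1 means that the range of \<open>H\<close> is a line, on which
  \<open>H ** X\<close> acts by a scalar.\<close>

lemma idempotent_trace_1:
  fixes H :: "complex^'n^'n"
  assumes "H ** H = H" "trace H = 1"
  shows "\<exists>g. H ** X ** H = cscale g H"
proof -
  have "vec.dim (range ((*v) H)) = 1" using trace_idempotent[OF assms(1)] assms(2) by simp
  then obtain B where B: "range ((*v) H) \<subseteq> vec.span B" "card B = 1" "B \<subseteq> range ((*v) H)"
    using vec.basis_exists by metis
  obtain v where v: "B = {v}" using B(2) card_1_singletonE by blast
  have "\<exists>c. H *v x = c *s v" for x
    using B(1) unfolding v vec.span_singleton by blast
  then obtain f where f: "H *v x = f x *s v" for x by metis
  have "H ** X ** H = cscale (f (X *v v)) H"
  proof (rule matrix_eqI_vec)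
    fix x
    have "(H ** X ** H) *v x = H *v (X *v (f x *s v))"
      by (simp only: f flip: matrix_vector_mul_assoc)
    also have "\<dots> = f x *s (H *v (X *v v))" by (simp only: vec.scale)
    also have "\<dots> = f (X *v v) *s (H *v x)" by (simp add: f mult.commute)
    finally show "(H ** X ** H) *v x = cscale (f (X *v v)) H *v x" by (simp add: cscale_mult_vec)
  qed
  then show ?thesis by blast
qed

context assoc_scheme
begin

text \<open>\<open>undefined\<close> is an arbitrary base point; \<open>card_neighbours\<close>
  removes the dependence on it for relations in \<open>S\<close>.\<close>

definition valency :: "('n \<times> 'n) set \<Rightarrow> nat" where
  "valency s = card {b. (undefined, b) \<in> s}"

text \<open>The neighbours are the paths out along \<open>s\<close> and back along its converse, and
  their number is constant on \<open>Id\<close>.\<close>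

lemma card_neighbours:
  assumes s: "s \<in> S"
  shows "card {b. (a, b) \<in> s} = valency s"
proof -
  have "card {b. (a, b) \<in> s \<and> (b, a) \<in> s\<inverse>} =
      card {b. (undefined, b) \<in> s \<and> (b, undefined) \<in> s\<inverse>}"
    by (rule card_paths_eq[OF s converse_mem[OF s] Id_mem]) auto
  then show ?thesis by (simp add: valency_def)
qed

lemma card_relation:
  assumes s: "s \<in> S"
  shows "card s = CARD('n) * valency s"
proof -
  have "s = Sigma UNIV (\<lambda>a. {b. (a, b) \<in> s})" by auto
  then have "card s = card (Sigma UNIV (\<lambda>a. {b. (a, b) \<in> s}))" by simp
  also have "\<dots> = (\<Sum>a\<in>UNIV. card {b. (a, b) \<in> s})" by (rule card_SigmaI) auto
  finally show ?thesis by (simp add: card_neighbours[OF s])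
qed

lemma valency_pos: "s \<in> S \<Longrightarrow> valency s > 0"
  using card_relation_pos[of s] card_relation[of s] by (cases "valency s") auto

lemma valency_Id: "valency Id = 1"
  by (simp add: valency_def)

lemma sum_valency: "(\<Sum>s\<in>S - {Id}. valency s) = CARD('n) - 1"
proof -
  have "disjoint S"
    using relations_eq by (auto simp: disjoint_def)
  then have "card (\<Union>S) = (\<Sum>s\<in>S. card s)"
    by (intro card_Union_disjoint) auto
  moreover have "\<Union>S = UNIV" using relation_ex by blast
  ultimately have "CARD('n) * CARD('n) = CARD('n) * (\<Sum>s\<in>S. valency s)"
    by (simp add: card_relation sum_distrib_left)
  then have "(\<Sum>s\<in>S. valency s) = CARD('n)" by simp
  then show ?thesis using sum.remove[OF finite_S Id_mem, of valency] by (simp add: valency_Id)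
qed

lemma adj_mult_P0:
  assumes "s \<in> S"
  shows "adj s ** P0 = cscale (of_nat (valency s)) P0" "P0 ** adj s = cscale (of_nat (valency s)) P0"
proof -
  have "(\<Sum>b\<in>UNIV. if (a, b) \<in> s then 1 else (0::complex)) = of_nat (valency s)" for a
    using card_neighbours[OF assms, of a] by (simp add: sum.If_cases)
  then show "adj s ** P0 = cscale (of_nat (valency s)) P0"
    by (simp add: vec_eq_iff matrix_matrix_mult_def flip: sum_divide_distrib)
  \<comment> \<open>In-degrees are valencies of the converse, which agree with those of
    \<open>s\<close> because both relations have the same size.\<close>
  have "card {b. (b, a) \<in> s} = valency s" for a
  proof -
    have "card {b. (b, a) \<in> s} = valency (s\<inverse>)" using card_neighbours[OF converse_mem[OF assms], of a] by simp
    moreover have "CARD('n) * valency s = CARD('n) * valency (s\<inverse>)"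
      using card_relation[OF assms] card_relation[OF converse_mem[OF assms]] by simp
    ultimately show ?thesis by simp
  qed
  then have "(\<Sum>b\<in>UNIV. if (b, a) \<in> s then 1 else (0::complex)) = of_nat (valency s)" for a
    by (simp add: sum.If_cases)
  then show "P0 ** adj s = cscale (of_nat (valency s)) P0"
    by (simp add: vec_eq_iff matrix_matrix_mult_def flip: sum_divide_distrib)
qed

lemma P0_mem: "P0 \<in> adj_alg S"
  by (rule adj_algI) simp

lemma adj_alg_mult_P0:
  assumes "X \<in> adj_alg S"
  shows "\<exists>c. X ** P0 = cscale c P0 \<and> P0 ** X = cscale c P0"
proof -
  obtain c where "X = (\<Sum>s\<in>S. cscale (c s) (adj s))" using assms by (auto simp: adj_alg_def)
  then have "X ** P0 = cscale (\<Sum>s\<in>S. c s * of_nat (valency s)) P0"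
    "P0 ** X = cscale (\<Sum>s\<in>S. c s * of_nat (valency s)) P0"
    by (simp_all add: matrix_mult_sum_left matrix_mult_sum_right adj_mult_P0 cscale_sum_left)
  then show ?thesis by blast
qed

lemma P0_central: "central S P0"
  using adj_alg_mult_P0 by (intro centralI P0_mem) metis

lemma P0_nonzero: "(P0 :: complex^'n^'n) \<noteq> 0"
  by (simp add: vec_eq_iff)

text \<open>The product is \<open>c\<close> times \<open>P0\<close> with c^2 = c. If
  \<open>c\<close> were 1, then \<open>P0\<close> would lie below the minimal idempotent
  \<open>P\<close> and equal it.\<close>

lemma cpi_nontriv_mult_P0:
  assumes "P \<in> cpi_nontriv S"
  shows "P0 ** P = 0"
proof -
  have P: "P \<in> cpi S" "P \<noteq> P0" using assms by (auto simp: cpi_nontriv_def)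
  obtain c where c: "P ** P0 = cscale c P0" "P0 ** P = cscale c P0"
    using adj_alg_mult_P0 central_mem[OF cpi_central[OF P(1)]] by blast
  have "cscale (c * c) P0 = P ** (P ** P0)" by (simp add: c)
  also have "\<dots> = cscale c P0" unfolding matrix_mul_assoc cpi_idem[OF P(1)] by (rule c)
  finally have "c = 0 \<or> c = 1" using P0_nonzero by (simp add: cscale_eq_iff)
  moreover have "c \<noteq> 1"
    using cpi_minimal[OF P(1) P0_central P0_idem] c P P0_nonzero by auto
  ultimately show ?thesis using c by simp
qed

section \<open>Entries and traces of the Casimir element\<close>

lemma casimir_nth:
  "casimir S (mat 1) $ a $ b = (\<Sum>s\<in>S. of_nat (card {x. (a, x) \<in> s \<and> (b, x) \<in> s}) / of_nat (card s))"
  by (simp add: casimir_def adj_mult_nth)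

lemma casimir_nth_diag: "casimir S (mat 1) $ a $ a = of_nat (card S) / of_nat CARD('n)"
proof -
  have "casimir S (mat 1) $ a $ a = (\<Sum>s\<in>S. 1 / of_nat CARD('n))"
    unfolding casimir_nth
    by (rule sum.cong) (use valency_pos in \<open>force simp: card_neighbours card_relation\<close>)+
  then show ?thesis by simp
qed

lemma inum_eq:
  assumes "r \<in> S" "s \<in> S" "t \<in> S" "(a, c) \<in> t"
  shows "inum r s t = card {b. (a, b) \<in> r \<and> (b, c) \<in> s}"
proof -
  have "(SOME p. p \<in> t) \<in> t" using assms(4) by (rule someI)
  then show ?thesis
    unfolding inum_def Let_def
    using card_paths_eq[OF assms(1-3) _ assms(4), of "fst (SOME p. p \<in> t)" "snd (SOME p. p \<in> t)"] by simp
qed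

text \<open>The term of \<open>Id\<close> vanishes off the diagonal, and all other relations share
  the size \<open>CARD('n) * k\<close>, so the denominators can be pulled out of the sum.\<close>

lemma casimir_nth_offdiag:
  assumes r: "r \<in> S - {Id}" "(a, b) \<in> r"
    and k: "\<And>s. s \<in> S - {Id} \<Longrightarrow> valency s = k"
  shows "casimir S (mat 1) $ a $ b = of_nat (cval S r) / (of_nat CARD('n) * of_nat k)"
proof -
  have ab: "a \<noteq> b" using r relations_eq[OF _ Id_mem, of r "(a, b)"] by auto
  have inum: "inum s (s\<inverse>) r = card {x. (a, x) \<in> s \<and> (b, x) \<in> s}" if "s \<in> S" for s
    using inum_eq[OF that converse_mem[OF that] _ r(2)] r(1) by simp
  have Id0: "{x. (a, x) \<in> Id \<and> (b, x) \<in> Id} = {}" using ab by auto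
  have "casimir S (mat 1) $ a $ b =
      (\<Sum>s\<in>S - {Id}. of_nat (card {x. (a, x) \<in> s \<and> (b, x) \<in> s}) / of_nat (card s))"
    unfolding casimir_nth sum.remove[OF finite_S Id_mem] Id0 by simp
  also have "\<dots> = (\<Sum>s\<in>S - {Id}. of_nat (inum s (s\<inverse>) r) / (of_nat CARD('n) * of_nat k))"
    by (rule sum.cong) (auto simp: inum card_relation k)
  also have "\<dots> = of_nat (\<Sum>s\<in>S - {Id}. inum s (s\<inverse>) r) / (of_nat CARD('n) * of_nat k)"
    by (simp add: sum_divide_distrib)
  also have "(\<Sum>s\<in>S - {Id}. inum s (s\<inverse>) r) = cval S r"
    unfolding cval_def sum.remove[OF finite_S Id_mem] inum[OF Id_mem] Id0 by simp
  finally show ?thesis .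
qed

text \<open>Each \<open>s\<close> contributes \<open>valency s / CARD('n)\<close>, and the valencies
  add up to the number of points.\<close>

lemma casimir_mult_P0: "casimir S (mat 1) ** P0 = P0"
proof -
  have "casimir S (mat 1) ** P0 = (\<Sum>s\<in>S. cscale (1 / of_nat (card s)) (adj s ** (adj (s\<inverse>) ** P0)))"
    by (simp add: casimir_def matrix_mult_sum_left matrix_mul_assoc)
  also have "\<dots> = (\<Sum>s\<in>S. cscale (of_nat (valency s) / of_nat CARD('n)) P0)"
  proof (rule sum.cong[OF refl])
    fix s assume s: "s \<in> S"
    have "CARD('n) * valency s = CARD('n) * valency (s\<inverse>)"
      using card_relation[OF s] card_relation[OF converse_mem[OF s]] by simp
    then show "cscale (1 / of_nat (card s)) (adj s ** (adj (s\<inverse>) ** P0)) =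
        cscale (of_nat (valency s) / of_nat CARD('n)) P0"
      using valency_pos[OF s] by (simp add: adj_mult_P0 s converse_mem card_relation)
  qed
  also have "\<dots> = cscale (of_nat (\<Sum>s\<in>S. valency s) / of_nat CARD('n)) P0"
    by (simp add: sum_divide_distrib cscale_sum_left)
  also have "(\<Sum>s\<in>S. valency s) = CARD('n)"
    using sum_valency sum.remove[OF finite_S Id_mem, of valency] by (simp add: valency_Id)
  finally show ?thesis by simp
qed

text \<open>\<open>trace (adj r ** casimir S (mat 1))\<close> is the value at \<open>adj r\<close> of the character of the regular
  representation.\<close>

lemma trace_adj_mult_casimir_Ints:
  assumes r: "r \<in> S"
  shows "trace (adj r ** casimir S (mat 1)) \<in> \<int>"
proof -
  have "trace (adj r ** casimir S (mat 1)) =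
      (\<Sum>s\<in>S. 1 / of_nat (card s) * trace (adj r ** adj s ** adj (s\<inverse>)))"
    by (simp add: casimir_def matrix_mult_sum_right trace_sum trace_cscale matrix_mul_assoc)
  also have "\<dots> \<in> \<int>"
  proof (rule Ints_sum)
    fix s assume s: "s \<in> S"
    then obtain a b where ab: "(a, b) \<in> s" using relation_nonempty by fastforce
    \<comment> \<open>The trace is \<open>card s\<close> times an entry of
      \<open>adj r ** adj s\<close>, which counts paths, so the denominator cancels.\<close>
    show "1 / of_nat (card s) * trace (adj r ** adj s ** adj (s\<inverse>)) \<in> \<int>"
      unfolding trace_mult_adj_converse_eq[OF adj_mult_adj_mem[OF r s] s ab] adj_mult_nth
      using relation_nonempty[OF s] by simp
  qed
  finally show ?thesis .
qed

lemma trace_P0: "trace (P0 :: complex^'n^'n) = 1"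
  by (simp add: trace_def)

lemma trace_adj_nondiag:
  assumes "r \<in> S - {Id}"
  shows "trace (adj r) = 0"
proof -
  have "(a, a) \<notin> r" for a using assms relations_eq[OF _ Id_mem, of r "(a, a)"] by auto
  then show ?thesis by (simp add: trace_def)
qed

section \<open>Pseudocyclic and equivalenced schemes\<close>

text \<open>Both sides have the same eigenvalue at each primitive idempotent: \<open>1 / q\<close>
  at the nontrivial ones and 1 at \<open>P0\<close>.\<close>

lemma casimir_pseudocyclic:
  assumes "\<And>P. P \<in> cpi_nontriv S \<Longrightarrow> mP S P / real (nP S P) = q"
  shows "casimir S (mat 1) = cscale (of_real (1 / q)) (mat 1) + cscale (of_real (1 - 1 / q)) P0"
    (is "?C = ?R")
proof -
  have "?C - ?R = 0"
  proof (rule eq_0_if_cpi_mult_eq_0)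
    fix P assume P: "P \<in> cpi S"
    show "(?C - ?R) ** P = 0"
    proof (cases "P = P0")
      case True
      then show ?thesis
        by (simp add: matrix_mult_diff_left matrix_mult_add_left casimir_mult_P0 P0_idem
            flip: cscale_add_left)
    next
      case False
      then have nt: "P \<in> cpi_nontriv S" using P by (simp add: cpi_nontriv_def)
      have "1 / q = real (nP S P) ^ 2 / real (rank P)"
        using assms[OF nt] by (auto simp: mP_def power2_eq_square)
      then have "of_real (1 / q) = (of_nat (nP S P) ^ 2 / of_nat (rank P) :: complex)"
        by simp
      then show ?thesis
        by (simp add: matrix_mult_diff_left matrix_mult_add_left casimir_mult_cpi[OF P]
            cpi_nontriv_mult_P0[OF nt])
    qed
  qed
  then show ?thesis by simp
qed

text \<open>The first identity is read from a diagonal entry. The second pairs the formula with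
  \<open>adj r\<close>, whose trace is 0, so that only the \<open>P0\<close> term survives.\<close>

lemma casimir_consequences:
  assumes q: "q \<noteq> 0"
    and C: "casimir S (mat 1) = cscale (of_real (1 / q)) (mat 1) + cscale (of_real (1 - 1 / q)) P0"
  shows "q * (real (card S) - 1) = real CARD('n) - 1"
    and "r \<in> S - {Id} \<Longrightarrow> \<exists>z::int. real_of_int z = (1 - 1 / q) * real (valency r)"
proof -
  have "(of_nat (card S) / of_nat CARD('n) :: complex) =
      of_real (1 / q) + of_real (1 - 1 / q) / of_nat CARD('n)"
    using arg_cong[OF C, of "\<lambda>M. M $ undefined $ undefined"] unfolding casimir_nth_diag
    by (simp add: mat_def)
  then have "complex_of_real (real (card S) / real CARD('n)) =
      of_real (1 / q + (1 - 1 / q) / real CARD('n))"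
    by simp
  then have "real (card S) / real CARD('n) = 1 / q + (1 - 1 / q) / real CARD('n)"
    by (simp only: of_real_eq_iff)
  then show "q * (real (card S) - 1) = real CARD('n) - 1"
    using q by (simp add: field_simps)
  assume r: "r \<in> S - {Id}"
  obtain z where z: "trace (adj r ** casimir S (mat 1)) = of_int z"
    using trace_adj_mult_casimir_Ints[of r] r by (auto elim: Ints_cases)
  have "complex_of_real (real_of_int z) = of_real ((1 - 1 / q) * real (valency r))"
    using z r by (simp add: C matrix_mult_add_right trace_plus trace_cscale trace_adj_nondiag
        adj_mult_P0 trace_P0)
  then have "real_of_int z = (1 - 1 / q) * real (valency r)" by (simp only: of_real_eq_iff)
  then show "\<exists>z::int. real_of_int z = (1 - 1 / q) * real (valency r)" by blast
qed

lemma equivalenced_iff: "equivalenced S k \<longleftrightarrow> (\<forall>s\<in>S - {Id}. valency s = k)"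
  by (simp add: equivalenced_def card_neighbours)

lemma card_S_pos: "card S > 0"
  using Id_mem finite_S card_gt_0_iff by blast

lemma pseudocyclic_imp_equivalenced:
  assumes k: "k > 0" and pc: "\<And>P. P \<in> cpi_nontriv S \<Longrightarrow> mP S P / real (nP S P) = real k"
  shows "equivalenced S k \<and> (\<forall>r\<in>S - {Id}. cval S r = k - 1)"
proof -
  note C = casimir_pseudocyclic[OF pc]
  have k0: "real k \<noteq> 0" using k by simp
  have "k dvd valency r" if r: "r \<in> S - {Id}" for r
  proof -
    obtain z :: int where "real_of_int z = (1 - 1 / real k) * real (valency r)"
      using casimir_consequences(2)[OF k0 C r] by blast
    then have "real_of_int (int k * z + int (valency r)) = real_of_int (int k * int (valency r))"
      using k by (simp add: field_simps)
    then have "int k * z + int (valency r) = int k * int (valency r)" by (simp only: of_int_eq_iff)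
    then have "int k dvd int (valency r)" by (metis dvd_add_right_iff dvd_triv_left)
    then show ?thesis by simp
  qed
  then have ge: "k \<le> valency r" if "r \<in> S - {Id}" for r
    using that valency_pos[of r] by (simp add: dvd_imp_le)
  have "real (k * (card S - 1)) = real (CARD('n) - 1)"
    using casimir_consequences(1)[OF k0 C] card_S_pos by (simp add: of_nat_diff)
  then have "(\<Sum>s\<in>S - {Id}. valency s) = (\<Sum>s\<in>S - {Id}. k)"
    using Id_mem unfolding sum_valency of_nat_eq_iff by (simp add: mult.commute)
  \<comment> \<open>By \<open>ge\<close> the truncated differences are true ones; as their sum
    vanishes, so does each.\<close>
  then have "(\<Sum>s\<in>S - {Id}. valency s - k) = 0"
    by (subst sum_subtractf_nat) (use ge in auto)
  then have val: "valency s = k" if "s \<in> S - {Id}" for s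
    using that ge by (simp add: le_antisym)
  have "cval S r = k - 1" if r: "r \<in> S - {Id}" for r
  proof -
    obtain a b where ab: "(a, b) \<in> r" using relation_nonempty[of r] r by fastforce
    have "a \<noteq> b" using r ab relations_eq[OF _ Id_mem, of r "(a, b)"] by auto
    then have "complex_of_nat (cval S r) / (of_nat CARD('n) * of_nat k) =
        (1 - 1 / of_nat k) / of_nat CARD('n)"
      using casimir_nth_offdiag[OF r ab val] arg_cong[OF C, of "\<lambda>M. M $ a $ b"] by (simp add: mat_def)
    \<comment> \<open>The form with \<open>+ 1\<close> transfers to the natural numbers without a
      truncated subtraction.\<close>
    then have "complex_of_nat (cval S r + 1) = of_nat k"
      using k by (simp add: field_simps)
    then show ?thesis by (simp only: of_nat_eq_iff)
  qed
  then show ?thesis using val by (simp add: equivalenced_iff)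
qed

text \<open>The hypotheses determine every entry of the Casimir element. Multiplying the resulting
  formula by \<open>P\<close> and comparing with \<open>casimir_mult_cpi\<close> gives the
  ratio.\<close>

lemma equivalenced_imp_pseudocyclic:
  assumes k: "k > 0" and eq: "equivalenced S k" and c: "\<And>r. r \<in> S - {Id} \<Longrightarrow> cval S r = k - 1"
    and P: "P \<in> cpi_nontriv S"
  shows "mP S P / real (nP S P) = real k"
proof -
  have val: "valency s = k" if "s \<in> S - {Id}" for s using eq that by (simp add: equivalenced_iff)
  have "card (S - {Id}) = card S - 1" using Id_mem by simp
  then have n: "CARD('n) - 1 = (card S - 1) * k"
    using sum_valency val by simp
  have "casimir S (mat 1) $ a $ b =
      (cscale (1 / of_nat k) (mat 1) + cscale (1 - 1 / of_nat k) P0) $ a $ b" for a b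
  proof (cases "a = b")
    case True
    \<comment> \<open>Here \<open>c\<close> is the number of non-identity relations, so there are
      \<open>c * k + 1\<close> points.\<close>
    obtain c where c: "card S = Suc c" using card_S_pos gr0_implies_Suc by blast
    then have "CARD('n) - 1 = c * k" "CARD('n) \<noteq> 0" using n by simp_all
    then have "CARD('n) = c * k + 1" by linarith
    then have N: "of_nat CARD('n) = of_nat c * of_nat k + (1 :: complex)"
      by (metis of_nat_1 of_nat_add of_nat_mult)
    have *: "(1 + x) / N = 1 / y + (1 - 1 / y) / N" if "N \<noteq> 0" "y \<noteq> 0" "N = x * y + 1"
      for x y N :: complex
      using that(1,2) by (simp add: divide_simps) (simp add: that(3) algebra_simps)
    have "(1 + of_nat c) / of_nat CARD('n) =
        1 / of_nat k + (1 - 1 / of_nat k) / (of_nat CARD('n) :: complex)"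
      by (rule *[OF _ _ N]) (use k in simp_all)
    then show ?thesis unfolding True casimir_nth_diag c by (simp add: mat_def)
  next
    case False
    obtain r where r: "r \<in> S" "(a, b) \<in> r" using relation_ex by blast
    then have r': "r \<in> S - {Id}" using False by auto
    have "casimir S (mat 1) $ a $ b = (of_nat k - 1) / (of_nat CARD('n) * of_nat k)"
      using casimir_nth_offdiag[OF r' r(2) val] c[OF r'] k by (simp add: of_nat_diff)
    then show ?thesis using k False by (simp add: mat_def[of 1] field_simps)
  qed
  then have C: "casimir S (mat 1) = cscale (1 / of_nat k) (mat 1) + cscale (1 - 1 / of_nat k) P0"
    by (simp only: vec_eq_iff) blast
  have P': "P \<in> cpi S" using P by (simp add: cpi_nontriv_def)
  have "cscale (of_nat (nP S P) ^ 2 / of_nat (rank P)) P = cscale (1 / of_nat k) P"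
    using casimir_mult_cpi[OF P'] cpi_nontriv_mult_P0[OF P]
    by (simp add: C matrix_mult_add_left)
  then have "complex_of_real (real (nP S P) ^ 2 / real (rank P)) = of_real (1 / real k)"
    using cpi_nonzero[OF P'] by (simp add: cscale_eq_iff)
  then have "real (nP S P) ^ 2 / real (rank P) = 1 / real k" by (simp only: of_real_eq_iff)
  moreover have "rank P > 0" using rank_idempotent_pos[OF cpi_idem[OF P'] cpi_nonzero[OF P']] .
  ultimately show ?thesis
    using nP_pos[OF P'] k by (simp add: mP_def field_simps power2_eq_square)
qed

text \<open>The sum of the irreducible characters other than the trivial one takes the value
  \<open>- valency r / m\<close> at \<open>adj r\<close>, where \<open>m\<close> is the common multiplicity; being an algebraic integer, it
  is at most \<open>-1\<close>.\<close>

lemma multiplicity_le_valency: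
  assumes m: "m > 0" and mP: "\<And>P. P \<in> cpi_nontriv S \<Longrightarrow> mP S P = m" and r: "r \<in> S - {Id}"
    and rat: "m \<in> \<rat>"
  shows "m \<le> real (valency r)"
proof -
  have A: "adj r \<in> adj_alg S" using r adj_mem by blast
  \<comment> \<open>Subtracting \<open>P0 ** E\<close> removes the trivial constituent, and the
    expression stays additive in \<open>E\<close>, as the induction requires.\<close>
  define Q where "Q E \<longleftrightarrow> integral_num (trace ((E - P0 ** E) ** adj r) / of_real m)" for E
  have "central_idem S (mat 1)" using central_mat_1 by (simp add: central_idem_iff)
  then have "Q (mat 1)"
  proof (induction rule: central_idem_induct)
    case zero
    show ?case by (simp add: Q_def trace_def)
  next
    case (add E F)
    have "trace ((E + F - P0 ** (E + F)) ** adj r) / of_real m =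
        trace ((E - P0 ** E) ** adj r) / of_real m + trace ((F - P0 ** F) ** adj r) / of_real m"
      by (simp add: matrix_mult_add_left matrix_mult_add_right matrix_mult_diff_left
          trace_plus trace_diff diff_divide_distrib add_divide_distrib)
    then show ?case using add integral_num_add unfolding Q_def by simp
  next
    case (cpi P)
    show ?case
    proof (cases "P = P0")
      case True
      then show ?thesis by (simp add: Q_def P0_idem trace_def)
    next
      case False
      then have nt: "P \<in> cpi_nontriv S" using cpi by (simp add: cpi_nontriv_def)
      obtain H where H: "H ** adj r ** H = adj r ** H"
        "trace (adj r ** H) = of_nat (nP S P) / of_nat (rank P) * trace (P ** adj r)"
        using ex_irred_projection[OF cpi] A by blast
      have "integral_num (trace (adj r ** H))"
        by (rule integral_num_trace_invariant[OF _ H(1)]) simp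
      \<comment> \<open>Division by \<open>m\<close> turns the trace on the range of
        \<open>P\<close> into the irreducible character value, which is integral since
        \<open>adj r\<close> has integer entries.\<close>
      moreover have "complex_of_real m = of_nat (rank P) / of_nat (nP S P)"
        using mP[OF nt] unfolding mP_def by (metis of_real_divide of_real_of_nat_eq)
      ultimately show ?thesis
        unfolding Q_def H(2) cpi_nontriv_mult_P0[OF nt] by (simp add: mult.commute)
    qed
  qed
  moreover have "trace ((mat 1 - P0 ** mat 1) ** adj r) / of_real m = of_real (- real (valency r) / m)"
    using r by (simp add: matrix_mult_diff_left trace_diff trace_adj_nondiag adj_mult_P0 trace_cscale trace_P0)
  ultimately have "integral_num (of_real (- real (valency r) / m))" unfolding Q_def by simp
  moreover have "complex_of_real (- real (valency r) / m) \<in> \<rat>"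
  proof -
    have "- real (valency r) / m \<in> \<rat>" using rat by simp
    then obtain a b :: int where "- real (valency r) / m = of_int a / of_int b"
      unfolding Rats_eq_int_div_int by blast
    then have "complex_of_real (- real (valency r) / m) = of_int a / of_int b" by simp
    then show ?thesis by simp
  qed
  ultimately have "complex_of_real (- real (valency r) / m) \<in> \<int>"
    by (rule rational_integral_num_imp_int)
  then obtain t where "complex_of_real (- real (valency r) / m) = of_int t" by (rule Ints_cases)
  then have t: "- real (valency r) / m = of_int t"
    by (metis of_real_eq_iff of_real_of_int_eq)
  have "- real (valency r) / m < 0" using m valency_pos[of r] r by simp
  then have "t < 0" unfolding t by simp
  then have "- real (valency r) / m \<le> -1" unfolding t by linarith
  then show ?thesis using m by (simp add: field_simps)
qed

section \<open>Commutativity\<close>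

text \<open>On a one-dimensional module \<open>A\<close> and \<open>B\<close> act by scalars, so the
  commutator \<open>Y\<close> kills \<open>H\<close>. As the character is a nonzero multiple of the
  trace against \<open>P\<close>, nondegeneracy gives \<open>Y ** P = 0\<close>; at
  \<open>P0\<close> the algebra acts by scalars as well.\<close>

lemma commutative_if_nP_eq_1:
  assumes "\<And>P. P \<in> cpi_nontriv S \<Longrightarrow> nP S P = 1"
  shows "commutative_scheme S"
  unfolding commutative_scheme_def
proof (intro ballI)
  fix A B assume A: "A \<in> adj_alg S" and B: "B \<in> adj_alg S"
  define Y where "Y = A ** B - B ** A"
  have Y: "Y \<in> adj_alg S" unfolding Y_def using A B by (intro adj_alg_diff adj_alg_mult)
  have "Y = 0"
  proof (rule eq_0_if_cpi_mult_eq_0)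
    fix P assume P: "P \<in> cpi S"
    show "Y ** P = 0"
    proof (cases "P = P0")
      case True
      obtain a b where "A ** P0 = cscale a P0" "B ** P0 = cscale b P0"
        using adj_alg_mult_P0 A B by blast
      then show ?thesis
        unfolding True Y_def by (simp add: matrix_mult_diff_left mult.commute flip: matrix_mul_assoc)
    next
      case False
      then have d: "nP S P = 1" using assms P by (simp add: cpi_nontriv_def)
      obtain H where H: "H ** H = H" "trace H = 1" "\<And>X. X \<in> adj_alg S \<Longrightarrow> H ** X ** H = X ** H"
        "\<And>X. X \<in> adj_alg S \<Longrightarrow> trace (X ** H) = 1 / of_nat (rank P) * trace (P ** X)"
        using ex_irred_projection[OF P] d by auto
      have "\<exists>g. X ** H = cscale g H" if "X \<in> adj_alg S" for X
        using idempotent_trace_1[OF H(1,2)] H(3)[OF that] by metis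
      then obtain a b where ab: "A ** H = cscale a H" "B ** H = cscale b H" using A B by blast
      have YH: "Y ** H = 0"
        unfolding Y_def by (simp add: matrix_mult_diff_left ab mult.commute flip: matrix_mul_assoc)
      show ?thesis
      proof (rule adj_alg_eq_0)
        show "Y ** P \<in> adj_alg S" using Y central_mem[OF cpi_central[OF P]] by (rule adj_alg_mult)
        fix X assume X: "X \<in> adj_alg S"
        have "0 = trace (X ** Y ** H)" by (simp add: YH trace_def flip: matrix_mul_assoc)
        also have "\<dots> = 1 / of_nat (rank P) * trace (P ** (X ** Y))" by (rule H(4)[OF adj_alg_mult[OF X Y]])
        finally have "trace (P ** (X ** Y)) = 0"
          using rank_idempotent_pos[OF cpi_idem[OF P] cpi_nonzero[OF P]] by simp
        then show "trace (Y ** P ** X) = 0"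
          using trace_mult_commute[of Y "P ** X"] by (simp add: matrix_mul_assoc)
      qed
    qed
  qed
  then show "A ** B = B ** A" by (simp add: Y_def)
qed

lemma commutative_if_pseudocyclic_const:
  assumes pc: "pseudocyclic S" and d: "\<And>P. P \<in> cpi_nontriv S \<Longrightarrow> nP S P = d"
  shows "commutative_scheme S"
proof (cases "cpi_nontriv S = {}")
  case True
  then show ?thesis by (intro commutative_if_nP_eq_1) auto
next
  case False
  then obtain P where P: "P \<in> cpi_nontriv S" by blast
  then have P': "P \<in> cpi S" by (simp add: cpi_nontriv_def)
  obtain q where q: "\<And>P. P \<in> cpi_nontriv S \<Longrightarrow> mP S P / real (nP S P) = q"
    using pc unfolding pseudocyclic_def by blast
  have d0: "d > 0" using nP_pos[OF P'] d[OF P] by simp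
  have rk: "rank P > 0" using rank_idempotent_pos[OF cpi_idem[OF P'] cpi_nonzero[OF P']] .
  have m: "mP S P = q * real d" if "P \<in> cpi_nontriv S" for P
    using q[OF that] d[OF that] d0 by (simp add: field_simps)
  \<comment> \<open>This exhibits \<open>q * real d\<close> as a quotient of natural numbers, hence
    as rational, which the bound on valencies requires.\<close>
  have q_eq: "q = real (rank P) / real d / real d" using q[OF P] d[OF P] by (simp add: mP_def)
  then have q0: "q > 0" and rat: "q * real d \<in> \<rat>" using d0 rk by simp_all
  note C = casimir_pseudocyclic[OF q]
  have card: "q * (real (card S) - 1) = real CARD('n) - 1"
    using casimir_consequences(1)[OF _ C] q0 by simp
  \<comment> \<open>On a single point \<open>P0\<close> is the identity and leaves no nontrivial
    idempotent. The strict bound lets the factor \<open>CARD('n) - 1\<close> be cancelled at the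
    end.\<close>
  have n: "CARD('n) > 1"
  proof (rule ccontr)
    assume "\<not> CARD('n) > 1"
    then have n1: "CARD('n) = 1" by (metis One_nat_def less_one linorder_neqE_nat zero_less_card_finite not_less_eq)
    then have "(P0 :: complex^'n^'n) = mat 1"
      by (auto simp: vec_eq_iff mat_def card_1_singleton_iff) (metis UNIV_I singletonD)
    then show False using cpi_nontriv_mult_P0[OF P] cpi_nonzero[OF P'] by (metis matrix_mul_lid)
  qed
  \<comment> \<open>Each non-identity valency is at least \<open>q * real d\<close>, while by
    \<open>card\<close> their average is \<open>q\<close>.\<close>
  have "(\<Sum>r\<in>S - {Id}. q * real d) \<le> (\<Sum>r\<in>S - {Id}. real (valency r))"
    using q0 d0 m rat by (intro sum_mono multiplicity_le_valency) auto
  also have "\<dots> = real CARD('n) - 1"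
    using arg_cong[OF sum_valency, of real] n by (simp add: of_nat_diff)
  also have "(\<Sum>r\<in>S - {Id}. q * real d) = (real CARD('n) - 1) * real d"
    using card card_S_pos Id_mem by (simp add: of_nat_diff mult_ac flip: card)
  finally have "real d \<le> 1" using n by simp
  then have "d = 1" using d0 by simp
  then show ?thesis using d by (intro commutative_if_nP_eq_1) simp
qed

end

theorem theorem2p2:
  fixes S :: "('n::finite \<times> 'n) set set" and k :: nat
  assumes "scheme S" and "0 < k"
  shows "((pseudocyclic S \<and> (\<forall>P\<in>cpi_nontriv S. mP S P / real (nP S P) = real k)) \<longleftrightarrow>
           (equivalenced S k \<and> (\<forall>r\<in>S - {Id}. cval S r = k - 1)))
         \<and> (pseudocyclic S \<and> (\<exists>d. \<forall>P\<in>cpi_nontriv S. nP S P = d) \<longrightarrow> commutative_scheme S)"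
proof -
  interpret assoc_scheme S by unfold_locales (rule assms(1))
  show ?thesis
  proof (intro conjI iffI impI; (elim conjE exE)?)
    assume "\<forall>P\<in>cpi_nontriv S. mP S P / real (nP S P) = real k"
    then show "equivalenced S k" "\<forall>r\<in>S - {Id}. cval S r = k - 1"
      using pseudocyclic_imp_equivalenced[OF assms(2)] by blast+
  next
    assume "equivalenced S k" "\<forall>r\<in>S - {Id}. cval S r = k - 1"
    then have *: "\<forall>P\<in>cpi_nontriv S. mP S P / real (nP S P) = real k"
      using equivalenced_imp_pseudocyclic[OF assms(2)] by blast
    then show "pseudocyclic S" unfolding pseudocyclic_def by blast
    show "\<forall>P\<in>cpi_nontriv S. mP S P / real (nP S P) = real k" by (rule *)
  next
    fix d assume "pseudocyclic S" "\<forall>P\<in>cpi_nontriv S. nP S P = d"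
    then show "commutative_scheme S" using commutative_if_pseudocyclic_const by blast
  qed
qed

end
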